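(* Let $K$ be a number field (a finite extension of $\mathbb{Q}$) and let $C\subseteq\omega$ be a cohesive set. If $K/\mathbb{Q}$ is Galois, then $\prod_C K/\prod_C\mathbb{Q}$ is Galois, and thus $\mathrm{Gal}(\prod_C K/\prod_C\mathbb{Q})\cong\mathrm{Gal}(K/\mathbb{Q})$.
   Context: For $A,B\subseteq\omega$, $A\subseteq^* B$ means $A\setminus B$ is finite. A set $C\subseteq\omega$ is cohesive if it is infinite and for every c.e. set $W$ either $C\subseteq^*W$ or $C\subseteq^*\overline{W}$. A computable structure has computable domain $\subseteq\omega$ and computable atomic diagram. For a computable structure $\mathcal A$ and cohesive $C$, the cohesive power $\prod_C\mathcal A$ has as domain the classes $[\varphi]$ of partial computable functions $\varphi$ from $\omega$ to $\mathcal{A}$ with $C\subseteq^*\mathrm{dom}(\varphi)$, where $[\varphi]=[\psi]$ iff $C\subseteq^*\{i:\varphi(i){\downarrow}=\psi(i){\downarrow}\}$; functions and constants are interpreted pointwise, and a relation $R$ holds of $[\varphi_0],\dots,[\varphi_{m-1}]$ iff $C\subseteq^*\{i: R^{\mathcal A}(\varphi_0(i),\dots,\varphi_{m-1}(i))\}$. $K$ is given a computable presentation as a field; $\prod_C\mathbb{Q}$ is regarded as the subfield of $\prod_CK$ of classes of partial computable functions with values in $\mathbb{Q}\subseteq K$. *)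

theory Defs
  imports
    "HOL-Algebra.Bij"
    "HOL-Algebra.Algebraic_Closure_Type"
    "HOL-Library.Nat_Bijection"
begin

section \<open>Partial computable functions and cohesive sets\<close>

text \<open>Programs for the partial recursive functions. Arities are not tracked: a program
  computes a partial function on argument lists of every length.\<close>

datatype recf =
    Zr
  | Sc
  | Pj nat
  | Cn recf "recf list"
  | Pr recf recf
  | Mn recf

inductive computes :: "recf \<Rightarrow> nat list \<Rightarrow> nat \<Rightarrow> bool" where
  zero: "computes Zr xs 0"
| succ: "computes Sc (x # xs) (Suc x)"
| proj: "i < length xs \<Longrightarrow> computes (Pj i) xs (xs ! i)"
| comp: "list_all2 (\<lambda>g y. computes g xs y) gs ys \<Longrightarrow> computes f ys z
           \<Longrightarrow> computes (Cn f gs) xs z"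
| prec_0: "computes f xs y \<Longrightarrow> computes (Pr f g) (0 # xs) y"
| prec_Suc: "computes (Pr f g) (n # xs) r \<Longrightarrow> computes g (n # r # xs) y
           \<Longrightarrow> computes (Pr f g) (Suc n # xs) y"
| mu: "computes f (n # xs) 0 \<Longrightarrow> (\<forall>m<n. \<exists>y>0. computes f (m # xs) y)
           \<Longrightarrow> computes (Mn f) xs n"

definition partial_computable :: "(nat \<rightharpoonup> nat) \<Rightarrow> bool" where
  "partial_computable \<phi> \<longleftrightarrow> (\<exists>p. \<forall>x y. \<phi> x = Some y \<longleftrightarrow> computes p [x] y)"

definition computable_set :: "nat set \<Rightarrow> bool" where
  "computable_set A \<longleftrightarrow> partial_computable (\<lambda>x. Some (if x \<in> A then 1 else 0))"

definition ce_set :: "nat set \<Rightarrow> bool" where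
  "ce_set W \<longleftrightarrow> (\<exists>\<phi>. partial_computable \<phi> \<and> W = dom \<phi>)"

definition almost_subset :: "nat set \<Rightarrow> nat set \<Rightarrow> bool" (infix \<open>\<subseteq>\<^sup>*\<close> 50) where
  "A \<subseteq>\<^sup>* B \<longleftrightarrow> finite (A - B)"

definition cohesive :: "nat set \<Rightarrow> bool" where
  "cohesive C \<longleftrightarrow> infinite C \<and> (\<forall>W. ce_set W \<longrightarrow> C \<subseteq>\<^sup>* W \<or> C \<subseteq>\<^sup>* - W)"

section \<open>Computable structures in the language of rings\<close>

text \<open>Closed terms of the language \<open>(+, *, 0, 1)\<close> expanded by a constant for each element
  of the structure.\<close>

datatype (consts_of: 'a) rterm =
    Const 'a
  | Zero
  | One
  | Plus "'a rterm" "'a rterm"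
  | Times "'a rterm" "'a rterm"

primrec rterm_val :: "('a, 'b) ring_scheme \<Rightarrow> 'a rterm \<Rightarrow> 'a" where
  "rterm_val R (Const a) = a"
| "rterm_val R Zero = \<zero>\<^bsub>R\<^esub>"
| "rterm_val R One = \<one>\<^bsub>R\<^esub>"
| "rterm_val R (Plus s t) = rterm_val R s \<oplus>\<^bsub>R\<^esub> rterm_val R t"
| "rterm_val R (Times s t) = rterm_val R s \<otimes>\<^bsub>R\<^esub> rterm_val R t"

primrec rterm_code :: "nat rterm \<Rightarrow> nat" where
  "rterm_code (Const a) = prod_encode (0, a)"
| "rterm_code Zero = prod_encode (1, 0)"
| "rterm_code One = prod_encode (2, 0)"
| "rterm_code (Plus s t) = prod_encode (3, prod_encode (rterm_code s, rterm_code t))"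
| "rterm_code (Times s t) = prod_encode (4, prod_encode (rterm_code s, rterm_code t))"

text \<open>Codes of the true atomic sentences \<open>s = t\<close> (tag 0) and of the true negated atomic
  sentences \<open>s \<noteq> t\<close> (tag 1).\<close>

definition atomic_diagram :: "(nat, 'b) ring_scheme \<Rightarrow> nat set" where
  "atomic_diagram R =
     {prod_encode (0, prod_encode (rterm_code s, rterm_code t)) | s t.
        consts_of s \<union> consts_of t \<subseteq> carrier R \<and> rterm_val R s = rterm_val R t} \<union>
     {prod_encode (1, prod_encode (rterm_code s, rterm_code t)) | s t.
        consts_of s \<union> consts_of t \<subseteq> carrier R \<and> rterm_val R s \<noteq> rterm_val R t}"

definition computable_structure :: "(nat, 'b) ring_scheme \<Rightarrow> bool" where
  "computable_structure R \<longleftrightarrow> computable_set (carrier R) \<and> computable_set (atomic_diagram R)"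

section \<open>Cohesive powers\<close>

text \<open>The partial computable functions with values in \<open>A\<close> that are defined on almost all
  of \<open>C\<close>.\<close>

definition cohesive_funs :: "nat set \<Rightarrow> nat set \<Rightarrow> (nat \<rightharpoonup> nat) set" where
  "cohesive_funs C A = {\<phi>. partial_computable \<phi> \<and> ran \<phi> \<subseteq> A \<and> C \<subseteq>\<^sup>* dom \<phi>}"

definition cohesive_class ::
  "nat set \<Rightarrow> (nat, 'b) ring_scheme \<Rightarrow> (nat \<rightharpoonup> nat) \<Rightarrow> (nat \<rightharpoonup> nat) set" where
  "cohesive_class C R \<phi> =
     {\<psi> \<in> cohesive_funs C (carrier R). C \<subseteq>\<^sup>* {i. \<exists>a. \<phi> i = Some a \<and> \<psi> i = Some a}}"

definition pointwise :: "('a \<Rightarrow> 'a \<Rightarrow> 'a) \<Rightarrow> (nat \<rightharpoonup> 'a) \<Rightarrow> (nat \<rightharpoonup> 'a) \<Rightarrow> (nat \<rightharpoonup> 'a)" where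
  "pointwise f \<phi> \<psi> =
     (\<lambda>i. case (\<phi> i, \<psi> i) of (Some a, Some b) \<Rightarrow> Some (f a b) | _ \<Rightarrow> None)"

text \<open>The class of \<open>pointwise f \<phi> \<psi>\<close> does not depend on the representatives \<open>\<phi> \<in> U\<close>,
  \<open>\<psi> \<in> V\<close>, so the unions below are unions of copies of a single class.\<close>

definition cohesive_power :: "nat set \<Rightarrow> (nat, 'b) ring_scheme \<Rightarrow> (nat \<rightharpoonup> nat) set ring" where
  "cohesive_power C R =
     \<lparr>carrier = cohesive_class C R ` cohesive_funs C (carrier R),
      monoid.mult = (\<lambda>U V. \<Union>\<phi>\<in>U. \<Union>\<psi>\<in>V. cohesive_class C R (pointwise (monoid.mult R) \<phi> \<psi>)),
      one = cohesive_class C R (\<lambda>_. Some \<one>\<^bsub>R\<^esub>),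
      ring.zero = cohesive_class C R (\<lambda>_. Some \<zero>\<^bsub>R\<^esub>),
      add = (\<lambda>U V. \<Union>\<phi>\<in>U. \<Union>\<psi>\<in>V. cohesive_class C R (pointwise (add R) \<phi> \<psi>))\<rparr>"

text \<open>The cohesive power of a substructure with domain \<open>A\<close>, as a subset of the cohesive
  power of \<open>R\<close>.\<close>

definition cohesive_subpower :: "nat set \<Rightarrow> (nat, 'b) ring_scheme \<Rightarrow> nat set
    \<Rightarrow> (nat \<rightharpoonup> nat) set set" where
  "cohesive_subpower C R A = cohesive_class C R ` cohesive_funs C A"

section \<open>Number fields and Galois extensions\<close>

definition prime_subfield :: "('a, 'b) ring_scheme \<Rightarrow> 'a set" where
  "prime_subfield K = \<Inter>{F. subfield F K}"

text \<open>The copy of \<open>\<rat>\<close> inside a number field is its prime subfield.\<close>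

definition number_field :: "('a, 'b) ring_scheme \<Rightarrow> bool" where
  "number_field K \<longleftrightarrow> Ring.field K \<and>
     (ring_of_type_algebra :: rat ring) \<simeq> K\<lparr>carrier := prime_subfield K\<rparr> \<and>
     ring.finite_dimension K (prime_subfield K) (carrier K)"

text \<open>Below, \<open>L\<close> is a field and \<open>F\<close> the domain of a subfield of \<open>L\<close>.\<close>

definition algebraic_extension :: "('a, 'b) ring_scheme \<Rightarrow> 'a set \<Rightarrow> bool" where
  "algebraic_extension L F \<longleftrightarrow> (\<forall>x\<in>carrier L. ring.algebraic L F x)"

definition normal_extension :: "('a, 'b) ring_scheme \<Rightarrow> 'a set \<Rightarrow> bool" where
  "normal_extension L F \<longleftrightarrow> algebraic_extension L F \<and>
     (\<forall>p\<in>carrier (univ_poly L F). pirreducible\<^bsub>L\<^esub> F p \<and> (\<exists>x\<in>carrier L. ring.eval L p x = \<zero>\<^bsub>L\<^esub>)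
        \<longrightarrow> ring.splitted L p)"

text \<open>The minimal polynomial of every element has only simple roots in an algebraic
  closure.\<close>

definition separable_extension :: "('a, 'b) ring_scheme \<Rightarrow> 'a set \<Rightarrow> bool" where
  "separable_extension L F \<longleftrightarrow> algebraic_extension L F \<and>
     (\<forall>x\<in>carrier L. \<forall>y\<in>carrier (field.alg_closure L).
        ring.alg_mult (field.alg_closure L) (map (ring.indexed_const L) (ring.Irr L F x)) y \<le> 1)"

definition galois_extension :: "('a, 'b) ring_scheme \<Rightarrow> 'a set \<Rightarrow> bool" where
  "galois_extension L F \<longleftrightarrow>
     Ring.field L \<and> subfield F L \<and> normal_extension L F \<and> separable_extension L F"

text \<open>Automorphisms are taken extensional, as in \<^const>\<open>AutoGroup\<close>.\<close>

definition galois_group :: "('a, 'b) ring_scheme \<Rightarrow> 'a set \<Rightarrow> ('a \<Rightarrow> 'a) monoid" where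
  "galois_group L F =
     BijGroup (carrier L)\<lparr>carrier := {\<sigma> \<in> ring_hom L L \<inter> Bij (carrier L). \<forall>x\<in>F. \<sigma> x = x}\<rparr>"

end

theory Submission
  imports Defs
begin

text \<open>A finite system of polynomial equations over \<open>K\<close>, some of whose unknowns range over \<open>\<rat>\<close>, can be
  solved by unbounded search, so solutions can be chosen partial computably in the data, and the
  set of indices where the system is solvable is c.e. By cohesiveness a system solvable at
  infinitely many indices in \<open>C\<close> has a solution in the cohesive power, with the rational unknowns in
  \<open>\<Prod>\<^sub>C \<rat>\<close>. Applied to the statement ``\<open>x\<close> is a root of a monic rational polynomial of degree \<open>d\<close>
  with \<open>d\<close> distinct roots'', this makes every element of \<open>\<Prod>\<^sub>C K\<close> a root of such a polynomial over
  \<open>\<Prod>\<^sub>C \<rat>\<close>, which gives normality and separability. Applied to coordinates in a basis of \<open>K\<close>, it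
  shows that automorphisms of \<open>K\<close> are computable, so that they act pointwise on \<open>\<Prod>\<^sub>C K\<close>, and that a
  basis of \<open>K\<close> spans \<open>\<Prod>\<^sub>C K\<close>. Finally, an automorphism of \<open>\<Prod>\<^sub>C K\<close> over \<open>\<Prod>\<^sub>C \<rat>\<close> maps the diagonal copy
  of \<open>K\<close> to itself, because all roots of the minimal polynomials already lie there, and it is
  therefore determined by an automorphism of \<open>K\<close>.\<close>

section \<open>Closure properties of the computable functions\<close>

text \<open>The obstacle is that only equations between terms are carried from the indices to the
  cohesive power. Being the minimal polynomial of an element is not of this form. It is replaced by
  the existence of some monic rational polynomial with as many distinct roots as its degree; this
  polynomial may be a proper multiple of the minimal one, because splitting with simple roots passes
  to divisors. Distinctness of the roots is in turn written as invertibility of their differences. A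
  system has a fixed shape, so the degree must be the same at all indices where it is used. The
  dimension of \<open>K\<close> over \<open>Q\<close> bounds the degree, so one degree occurs at
  infinitely many points of \<open>C\<close>, and cohesiveness turns "infinitely often" into "almost
  always". The atomic diagram decides equations but does not hand out values: even sums in
  \<open>K\<close> are found by search. Rational unknowns are sought through an enumeration of
  \<open>Q\<close>, so that no test of membership in \<open>Q\<close> enters.\<close>

definition pcomp :: "nat \<Rightarrow> (nat list \<Rightarrow> nat option) \<Rightarrow> bool" where
  "pcomp n f \<longleftrightarrow> (\<exists>p. \<forall>xs y. length xs = n \<longrightarrow> (f xs = Some y \<longleftrightarrow> computes p xs y))"

definition tcomp :: "nat \<Rightarrow> (nat list \<Rightarrow> nat) \<Rightarrow> bool" where
  "tcomp n f \<longleftrightarrow> pcomp n (\<lambda>xs. Some (f xs))"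

lemma partial_computable_iff_pcomp: "partial_computable \<phi> \<longleftrightarrow> pcomp 1 (\<lambda>xs. \<phi> (hd xs))"
  unfolding partial_computable_def pcomp_def
  by (auto simp: length_Suc_conv) (metis length_Cons list.sel(1) list.size(3))+

\<comment> \<open>Composition, primitive recursion and iteration\<close>
inductive_simps computes_Zr: "computes Zr xs y"
inductive_simps computes_Sc: "computes Sc xs y"
inductive_simps computes_Pj: "computes (Pj i) xs y"
inductive_simps computes_Cn: "computes (Cn f gs) xs y"
inductive_simps computes_Pr_0: "computes (Pr f g) (0 # xs) y"
inductive_simps computes_Pr_Suc: "computes (Pr f g) (Suc k # xs) y"
inductive_simps computes_Mn: "computes (Mn f) xs y"

text \<open>Programs run on lists of every length, but \<open>pcomp n\<close> constrains them only
  at length \<open>n\<close>. The closure lemmas use this freedom to exchange presentations of a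
  function by \<open>hd\<close>, \<open>tl\<close> and \<open>nth\<close>.\<close>

lemma pcomp_cong:
  assumes "pcomp n f" "\<And>xs. length xs = n \<Longrightarrow> f xs = g xs"
  shows "pcomp n g"
  using assms unfolding pcomp_def by metis

lemma tcomp_cong:
  assumes "tcomp n f" "\<And>xs. length xs = n \<Longrightarrow> f xs = g xs"
  shows "tcomp n g"
  using assms pcomp_cong unfolding tcomp_def by (metis (no_types, lifting))

lemma tcomp_E:
  assumes "tcomp n f"
  obtains p where "\<And>xs y. length xs = n \<Longrightarrow> computes p xs y \<longleftrightarrow> y = f xs"
proof -
  obtain p where "\<forall>xs y. length xs = n \<longrightarrow> (Some (f xs) = Some y \<longleftrightarrow> computes p xs y)"
    using assms unfolding tcomp_def pcomp_def by blast
  then have "computes p xs y \<longleftrightarrow> y = f xs" if "length xs = n" for xs y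
    using that by (metis option.inject)
  then show thesis by (rule that)
qed

lemma tcomp_I:
  assumes "\<And>xs y. length xs = n \<Longrightarrow> computes p xs y \<longleftrightarrow> y = f xs"
  shows "tcomp n f"
  using assms unfolding tcomp_def pcomp_def by (intro exI[of _ p]) auto

text \<open>The condition on \<open>gs\<close> is the strictness of \<open>Cn\<close>: its rule asks
  for a value of every inner program, even of one whose value the outer program ignores.\<close>

lemma pcomp_comp:
  assumes f: "pcomp (length gs) f" and gs: "\<And>g. g \<in> set gs \<Longrightarrow> pcomp n g"
  shows "pcomp n (\<lambda>xs. if \<forall>g\<in>set gs. g xs \<noteq> None then f (map (\<lambda>g. the (g xs)) gs) else None)"
proof -
  obtain p where p: "\<And>xs y. length xs = length gs \<Longrightarrow> f xs = Some y \<longleftrightarrow> computes p xs y"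
    using f unfolding pcomp_def by auto
  have "\<forall>g\<in>set gs. \<exists>q. \<forall>xs y. length xs = n \<longrightarrow> (g xs = Some y \<longleftrightarrow> computes q xs y)"
    using gs unfolding pcomp_def by auto
  then obtain Q where Q: "\<And>g xs y. g \<in> set gs \<Longrightarrow> length xs = n \<Longrightarrow> g xs = Some y \<longleftrightarrow> computes (Q g) xs y"
    by metis
  show ?thesis unfolding pcomp_def
  proof (intro exI[of _ "Cn p (map Q gs)"] allI impI)
    fix xs :: "nat list" and y assume l: "length xs = n"
    have eq: "list_all2 (\<lambda>g. computes g xs) (map Q gs) ys
        \<longleftrightarrow> (\<forall>g\<in>set gs. g xs \<noteq> None) \<and> ys = map (\<lambda>g. the (g xs)) gs" for ys
    proof -
      have "list_all2 (\<lambda>g. computes g xs) (map Q gs) ys \<longleftrightarrow> list_all2 (\<lambda>g y. g xs = Some y) gs ys"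
        using Q l by (auto simp: list_all2_conv_all_nth)
      also have "\<dots> \<longleftrightarrow> (\<forall>g\<in>set gs. g xs \<noteq> None) \<and> ys = map (\<lambda>g. the (g xs)) gs"
      proof
        assume *: "list_all2 (\<lambda>g y. g xs = Some y) gs ys"
        then have "\<forall>g\<in>set gs. g xs \<noteq> None"
          by (auto simp: list_all2_conv_all_nth in_set_conv_nth)
        moreover have "ys = map (\<lambda>g. the (g xs)) gs"
          using * by (intro nth_equalityI) (auto simp: list_all2_conv_all_nth)
        ultimately show "(\<forall>g\<in>set gs. g xs \<noteq> None) \<and> ys = map (\<lambda>g. the (g xs)) gs" ..
      next
        assume *: "(\<forall>g\<in>set gs. g xs \<noteq> None) \<and> ys = map (\<lambda>g. the (g xs)) gs"
        then show "list_all2 (\<lambda>g y. g xs = Some y) gs ys"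
          by (simp add: list_all2_conv_all_nth)
      qed
      finally show ?thesis .
    qed
    have "computes (Cn p (map Q gs)) xs y \<longleftrightarrow>
        (\<exists>ys. ((\<forall>g\<in>set gs. g xs \<noteq> None) \<and> ys = map (\<lambda>g. the (g xs)) gs) \<and> computes p ys y)"
      unfolding computes_Cn eq ..
    also have "\<dots> \<longleftrightarrow> (\<forall>g\<in>set gs. g xs \<noteq> None) \<and> computes p (map (\<lambda>g. the (g xs)) gs) y"
      by blast
    finally have "computes (Cn p (map Q gs)) xs y \<longleftrightarrow>
        (\<forall>g\<in>set gs. g xs \<noteq> None) \<and> computes p (map (\<lambda>g. the (g xs)) gs) y" .
    then show "(if \<forall>g\<in>set gs. g xs \<noteq> None then f (map (\<lambda>g. the (g xs)) gs) else None) = Some y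
        \<longleftrightarrow> computes (Cn p (map Q gs)) xs y"
      using p[of "map (\<lambda>g. the (g xs)) gs" y] by auto
  qed
qed

lemma tcomp_comp:
  assumes "tcomp (length gs) f" "\<And>g. g \<in> set gs \<Longrightarrow> tcomp n g"
  shows "tcomp n (\<lambda>xs. f (map (\<lambda>g. g xs) gs))"
proof -
  have *: "pcomp (length (map (\<lambda>g xs. Some (g xs)) gs)) (\<lambda>xs. Some (f xs))"
    using assms(1) unfolding tcomp_def by simp
  show ?thesis
    unfolding tcomp_def
    by (rule pcomp_cong[OF pcomp_comp[OF *, of n]]) (use assms(2) in \<open>auto simp: tcomp_def comp_def\<close>)
qed

lemma tcomp_comp1:
  assumes "tcomp 1 (\<lambda>xs. f (xs ! 0))" "tcomp n g"
  shows "tcomp n (\<lambda>xs. f (g xs))"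
  using tcomp_comp[of "[g]" "\<lambda>xs. f (xs ! 0)" n] assms by simp

lemma tcomp_comp2:
  assumes "tcomp 2 (\<lambda>xs. f (xs ! 0) (xs ! 1))" "tcomp n g" "tcomp n h"
  shows "tcomp n (\<lambda>xs. f (g xs) (h xs))"
  using tcomp_comp[of "[g, h]" "\<lambda>xs. f (xs ! 0) (xs ! 1)" n] assms by (auto simp: numeral_2_eq_2)

lemma tcomp_nth: "i < n \<Longrightarrow> tcomp n (\<lambda>xs. xs ! i)"
  by (rule tcomp_I[of _ "Pj i"]) (auto simp: computes_Pj)

lemma tcomp_Suc: "tcomp n f \<Longrightarrow> tcomp n (\<lambda>xs. Suc (f xs))"
  by (rule tcomp_comp1, rule tcomp_I[of _ Sc]) (auto simp: computes_Sc length_Suc_conv)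

lemma tcomp_const: "tcomp n (\<lambda>_. c)"
proof (induction c)
  case 0
  show ?case by (rule tcomp_I[of _ Zr]) (auto simp: computes_Zr)
qed (rule tcomp_Suc)

text \<open>The list \<open>k # r # tl xs\<close> follows the rule for \<open>Pr\<close>: counter,
  previous value, parameters.\<close>

lemma tcomp_rec_nat:
  assumes "tcomp n f" "tcomp (Suc (Suc n)) g"
  shows "tcomp (Suc n) (\<lambda>xs. rec_nat (f (tl xs)) (\<lambda>k r. g (k # r # tl xs)) (hd xs))"
proof -
  obtain p q where p: "\<And>xs y. length xs = n \<Longrightarrow> computes p xs y \<longleftrightarrow> y = f xs"
    and q: "\<And>xs y. length xs = Suc (Suc n) \<Longrightarrow> computes q xs y \<longleftrightarrow> y = g xs"
    using assms by (elim tcomp_E) blast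
  have "computes (Pr p q) (k # xs) y \<longleftrightarrow> y = rec_nat (f xs) (\<lambda>k r. g (k # r # xs)) k"
    if "length xs = n" for k xs y
    using that by (induction k arbitrary: y) (auto simp: computes_Pr_0 computes_Pr_Suc p q)
  then show ?thesis
    by (intro tcomp_I[of _ "Pr p q"]) (auto simp: length_Suc_conv)
qed

text \<open>Iteration is primitive recursion whose step ignores the counter. Addition, truncated
  subtraction, decoding of tuples and codes of numerals are all obtained from it.\<close>

lemma tcomp_iterate:
  assumes "tcomp 1 (\<lambda>xs. f (xs ! 0))" "tcomp n g" "tcomp n h"
  shows "tcomp n (\<lambda>xs. (f ^^ g xs) (h xs))"
proof (rule tcomp_comp2[OF _ assms(2,3)])
  \<comment> \<open>Position 1 of the three arguments of the step is the previous value; position 0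
    holds the counter and position 2 the starting point.\<close>
  have "tcomp 3 (\<lambda>xs. f (xs ! 1))"
    by (rule tcomp_comp1[OF assms(1)]) (rule tcomp_nth, simp)
  then have 1: "tcomp (Suc 1) (\<lambda>xs. rec_nat (tl xs ! 0) (\<lambda>k r. f ((k # r # tl xs) ! 1)) (hd xs))"
    by (intro tcomp_rec_nat[OF tcomp_nth, of 0 1 "\<lambda>xs. f (xs ! 1)"]) (auto simp: numeral_3_eq_3)
  have 2: "rec_nat a (\<lambda>k r. f r) k = (f ^^ k) a" for k a
    by (induction k) auto
  show "tcomp 2 (\<lambda>xs. (f ^^ (xs ! 0)) (xs ! 1))"
    unfolding Suc_1[symmetric]
    by (rule tcomp_cong[OF 1]) (auto simp: 2 length_Suc_conv)
qed

section \<open>Arithmetic, pairing and unbounded search\<close>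

lemma tcomp_add: "tcomp n f \<Longrightarrow> tcomp n g \<Longrightarrow> tcomp n (\<lambda>xs. f xs + g xs)"
proof -
  assume *: "tcomp n f" "tcomp n g"
  have "tcomp n (\<lambda>xs. (Suc ^^ f xs) (g xs))"
    by (rule tcomp_iterate[OF _ *]) (rule tcomp_Suc, rule tcomp_nth, simp)
  then show ?thesis by (simp add: Suc_funpow)
qed

lemma tcomp_pred: "tcomp n f \<Longrightarrow> tcomp n (\<lambda>xs. f xs - 1)"
proof (rule tcomp_comp1[where f = "\<lambda>x. x - 1"])
  \<comment> \<open>The step discards the previous value and returns the counter, whose last value
    is the predecessor.\<close>
  have 1: "tcomp (Suc 0) (\<lambda>xs. rec_nat 0 (\<lambda>k r. (k # r # tl xs) ! 0) (hd xs))"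
    by (rule tcomp_rec_nat[OF tcomp_const tcomp_nth]) simp
  have "rec_nat 0 (\<lambda>k r. k) k = k - 1" for k :: nat
    by (cases k) auto
  then show "tcomp 1 (\<lambda>xs. xs ! 0 - 1)"
    unfolding One_nat_def by (intro tcomp_cong[OF 1]) (auto simp: length_Suc_conv)
qed

lemma tcomp_diff: "tcomp n f \<Longrightarrow> tcomp n g \<Longrightarrow> tcomp n (\<lambda>xs. f xs - g xs)"
proof -
  assume *: "tcomp n f" "tcomp n g"
  have "((\<lambda>x. x - 1) ^^ k) a = a - k" for a k :: nat
    by (induction k) auto
  moreover have "tcomp n (\<lambda>xs. ((\<lambda>x. x - 1) ^^ g xs) (f xs))"
    by (rule tcomp_iterate[OF _ *(2,1)]) (rule tcomp_pred, rule tcomp_nth, simp)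
  ultimately show ?thesis by simp
qed

lemma tcomp_triangle: "tcomp n f \<Longrightarrow> tcomp n (\<lambda>xs. triangle (f xs))"
proof (rule tcomp_comp1[where f = triangle])
  have 1: "tcomp (Suc 0) (\<lambda>xs. rec_nat 0 (\<lambda>k r. (k # r # tl xs) ! 1 + Suc ((k # r # tl xs) ! 0)) (hd xs))"
    by (rule tcomp_rec_nat, rule tcomp_const, intro tcomp_add tcomp_nth tcomp_Suc) simp_all
  have "rec_nat 0 (\<lambda>k r. r + Suc k) k = triangle k" for k
    by (induction k) auto
  then show "tcomp 1 (\<lambda>xs. triangle (xs ! 0))"
    unfolding One_nat_def by (intro tcomp_cong[OF 1]) (auto simp: length_Suc_conv)
qed

lemma tcomp_prod_encode: "tcomp n f \<Longrightarrow> tcomp n g \<Longrightarrow> tcomp n (\<lambda>xs. prod_encode (f xs, g xs))"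
  unfolding prod_encode_def by (auto intro!: tcomp_add tcomp_triangle)

text \<open>Since \<open>f\<close> is total, every candidate before the first zero has a defined
  positive value, as the rule for \<open>Mn\<close> demands. The program therefore halts exactly
  when a zero exists.\<close>

lemma pcomp_search:
  assumes "tcomp (Suc n) f"
  shows "pcomp n (\<lambda>xs. if \<exists>t. f (t # xs) = 0 then Some (LEAST t. f (t # xs) = 0) else None)"
proof -
  obtain p where p: "\<And>xs y. length xs = Suc n \<Longrightarrow> computes p xs y \<longleftrightarrow> y = f xs"
    using tcomp_E[OF assms] by blast
  have "(if \<exists>t. f (t # xs) = 0 then Some (LEAST t. f (t # xs) = 0) else None) = Some t
      \<longleftrightarrow> f (t # xs) = 0 \<and> (\<forall>m<t. 0 < f (m # xs))" for xs t
    by (auto dest: not_less_Least intro: LeastI intro!: Least_equality)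
      (metis not_le_imp_less less_numeral_extra(3))
  then show ?thesis
    unfolding pcomp_def by (intro exI[of _ "Mn p"]) (auto simp: computes_Mn p)
qed

lemma tcomp_search:
  assumes "tcomp (Suc n) f" "\<And>xs. length xs = n \<Longrightarrow> \<exists>t. f (t # xs) = 0"
  shows "tcomp n (\<lambda>xs. LEAST t. f (t # xs) = 0)"
  unfolding tcomp_def by (rule pcomp_cong[OF pcomp_search[OF assms(1)]]) (simp add: assms(2))

text \<open>The diagonal of the Cantor pairing containing \<open>t\<close> is the least \<open>s\<close> with
  \<open>t < triangle (s + 1)\<close>.\<close>

lemma tcomp_prod_decode:
  assumes "tcomp n f"
  shows "tcomp n (\<lambda>xs. fst (prod_decode (f xs)))" "tcomp n (\<lambda>xs. snd (prod_decode (f xs)))"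
proof -
  let ?s = "\<lambda>t. LEAST s. Suc t - triangle (Suc s) = 0"
  have mono: "triangle a \<le> triangle b" if "a \<le> b" for a b
    using that by (induction rule: dec_induct) auto
  have s: "?s (prod_encode (a, b)) = a + b" for a b
  proof (rule Least_equality)
    show "Suc (prod_encode (a, b)) - triangle (Suc (a + b)) = 0"
      by (simp add: prod_encode_def)
  next
    fix s assume *: "Suc (prod_encode (a, b)) - triangle (Suc s) = 0"
    show "a + b \<le> s"
    proof (rule ccontr)
      assume "\<not> a + b \<le> s"
      then have "triangle (Suc s) \<le> triangle (a + b)" by (intro mono) simp
      with * show False by (simp add: prod_encode_def)
    qed
  qed
  have "tcomp 1 (\<lambda>xs. ?s (xs ! 0))"
  proof (rule tcomp_cong[OF tcomp_search])
    show "tcomp (Suc 1) (\<lambda>xs. Suc (xs ! 1) - triangle (Suc (xs ! 0)))"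
      by (intro tcomp_diff tcomp_Suc tcomp_triangle tcomp_nth) simp_all
    fix xs :: "nat list" assume "length xs = 1"
    have "\<exists>t. Suc (xs ! 0) - triangle (Suc t) = 0"
      by (intro exI[of _ "xs ! 0"]) simp
    then show "\<exists>t. Suc ((t # xs) ! 1) - triangle (Suc ((t # xs) ! 0)) = 0" by simp
  qed simp
  then have ts: "tcomp n (\<lambda>xs. ?s (f xs))"
    using assms by (rule tcomp_comp1)
  \<comment> \<open>\<open>prod_encode (a, b)\<close> is \<open>triangle (a + b) + a\<close>: the
    first component is the offset on the diagonal \<open>a + b\<close>, the second is what remains
    of the diagonal.\<close>
  have dec: "prod_decode t = (t - triangle (?s t), ?s t - (t - triangle (?s t)))" for t
  proof -
    obtain a b where t: "t = prod_encode (a, b)" by (metis prod_decode_inverse surj_pair)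
    show ?thesis unfolding t s prod_encode_inverse by (simp add: prod_encode_def)
  qed
  show "tcomp n (\<lambda>xs. fst (prod_decode (f xs)))" "tcomp n (\<lambda>xs. snd (prod_decode (f xs)))"
    unfolding dec fst_conv snd_conv using assms ts
    by (auto intro!: tcomp_diff tcomp_triangle)
qed

text \<open>A number is read as an infinite nested pair whose entry at position \<open>j\<close> is
  returned. No length is recorded, so every number codes a candidate tuple of any required
  length.\<close>

definition proj_code :: "nat \<Rightarrow> nat \<Rightarrow> nat" where
  "proj_code j t = fst (prod_decode (((\<lambda>u. snd (prod_decode u)) ^^ j) t))"

lemma tcomp_proj_code: "tcomp n f \<Longrightarrow> tcomp n (\<lambda>xs. proj_code j (f xs))"
  unfolding proj_code_def
  by (rule tcomp_prod_decode(1),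
      rule tcomp_iterate[where f = "\<lambda>u. snd (prod_decode u)" and g = "\<lambda>_. j"])
    (auto intro!: tcomp_prod_decode(2) tcomp_nth tcomp_const)

text \<open>This is what makes a search through all numbers exhaustive: each finite tuple of
  candidates has a code.\<close>

lemma proj_code_surj: "\<exists>t. \<forall>j<m. proj_code j t = a j"
proof (induction m arbitrary: a)
  case (Suc m)
  obtain t where t: "\<forall>j<m. proj_code j t = a (Suc j)" using Suc[of "\<lambda>j. a (Suc j)"] by auto
  have "proj_code j (prod_encode (a 0, t)) = a j" if "j < Suc m" for j
    using t that by (cases j) (auto simp: proj_code_def funpow_Suc_right simp del: funpow.simps)
  then show ?case by blast
qed simp

lemma tcomp_sum_list:
  "(\<And>x. x \<in> set xs \<Longrightarrow> tcomp n (f x)) \<Longrightarrow> tcomp n (\<lambda>ys. \<Sum>x\<leftarrow>xs. f x ys)"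
  by (induction xs) (auto intro: tcomp_const tcomp_add)

text \<open>Zero stands for success, contrary to the indicator in \<open>computable_set\<close>:
  minimisation looks for zeros, and a sum of such tests is their conjunction.\<close>

lemma tcomp_computable_set:
  assumes "computable_set A" "tcomp n f"
  shows "tcomp n (\<lambda>xs. if f xs \<in> A then 0 else 1)"
proof -
  have "tcomp 1 (\<lambda>xs. 1 - (if xs ! 0 \<in> A then 1 else 0))"
  proof (intro tcomp_diff tcomp_const)
    show "tcomp 1 (\<lambda>xs. if xs ! 0 \<in> A then 1 else 0)"
      using assms(1) unfolding computable_set_def partial_computable_iff_pcomp tcomp_def
      by (rule pcomp_cong) (auto simp: length_Suc_conv)
  qed
  from tcomp_comp1[OF tcomp_cong[OF this, of "\<lambda>xs. if xs ! 0 \<in> A then 0 else 1"] assms(2)]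
  show ?thesis by auto
qed

lemma partial_computable_const: "partial_computable (\<lambda>_. Some c)"
  using tcomp_const[of 1 c] unfolding tcomp_def partial_computable_iff_pcomp .

lemma partial_computable_map:
  assumes "tcomp 1 (\<lambda>xs. f (xs ! 0))" "partial_computable \<phi>"
  shows "partial_computable (\<lambda>i. map_option f (\<phi> i))"
proof -
  have "pcomp (length [\<lambda>xs. \<phi> (hd xs)]) (\<lambda>xs. Some (f (xs ! 0)))"
    using assms(1) by (simp add: tcomp_def)
  from pcomp_comp[OF this] have "pcomp 1 (\<lambda>xs. if \<forall>g\<in>set [\<lambda>xs. \<phi> (hd xs)]. g xs \<noteq> None
      then Some (f (map (\<lambda>g. the (g xs)) [\<lambda>xs. \<phi> (hd xs)] ! 0)) else None)"
    using assms(2)[unfolded partial_computable_iff_pcomp] by simp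
  then show ?thesis
    unfolding partial_computable_iff_pcomp by (rule pcomp_cong) (auto simp: map_option_case)
qed

section \<open>Solving equations in a computable number field\<close>

lemma rterm_code_inj: "rterm_code s = rterm_code t \<Longrightarrow> s = t"
proof (induction s arbitrary: t)
  case (Const x) then show ?case by (cases t) (auto simp: prod_encode_eq)
next
  case Zero then show ?case by (cases t) (auto simp: prod_encode_eq)
next
  case One then show ?case by (cases t) (auto simp: prod_encode_eq)
next
  case (Plus s1 s2) then show ?case by (cases t) (auto simp: prod_encode_eq)
next
  case (Times s1 s2) then show ?case by (cases t) (auto simp: prod_encode_eq)
qed

lemma finite_consts_of: "finite (consts_of t)"
  by (induction t) auto

text \<open>The term \<open>s\<close> is fixed and only the constants put into it vary, so its code
  is a fixed nesting of pairings applied to computable entries.\<close>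

lemma tcomp_rterm_code:
  assumes "\<And>v. v \<in> consts_of s \<Longrightarrow> tcomp n (\<lambda>xs. V xs v)"
  shows "tcomp n (\<lambda>xs. rterm_code (map_rterm (V xs) s))"
  using assms by (induction s) (auto intro!: tcomp_prod_encode tcomp_const)

text \<open>One query to the diagram also checks that the constants lie in the domain. The searches
  below rely on this to reject candidates outside \<open>K\<close>.\<close>

lemma tcomp_term_equation:
  assumes "computable_structure R"
    and "tcomp n (\<lambda>xs. rterm_code (s xs))" "tcomp n (\<lambda>xs. rterm_code (t xs))"
  shows "tcomp n (\<lambda>xs. if consts_of (s xs) \<union> consts_of (t xs) \<subseteq> carrier R
      \<and> rterm_val R (s xs) = rterm_val R (t xs) then 0 else 1)"
proof -
  have "prod_encode (0, prod_encode (rterm_code a, rterm_code b)) \<in> atomic_diagram R \<longleftrightarrow>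
      consts_of a \<union> consts_of b \<subseteq> carrier R \<and> rterm_val R a = rterm_val R b" for a b
    unfolding atomic_diagram_def by (auto simp: prod_encode_eq dest: rterm_code_inj)
  moreover have "tcomp n (\<lambda>xs. if prod_encode (0, prod_encode (rterm_code (s xs), rterm_code (t xs)))
      \<in> atomic_diagram R then 0 else 1)"
    using assms unfolding computable_structure_def
    by (intro tcomp_computable_set tcomp_prod_encode tcomp_const) auto
  ultimately show ?thesis by simp
qed

lemma sum_list_indicator_eq_0:
  "(\<Sum>(s, t)\<leftarrow>xs. if p s t then 0 else 1 :: nat) = 0 \<longleftrightarrow> (\<forall>(s, t)\<in>set xs. p s t)"
  by (induction xs) (auto split: if_splits)

primrec nat_term :: "nat \<Rightarrow> 'a rterm" where
  "nat_term 0 = Zero"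
| "nat_term (Suc n) = Plus (nat_term n) One"

lemma consts_of_nat_term [simp]: "consts_of (nat_term n) = {}"
  by (induction n) auto

text \<open>Here the shape of the term varies with the input, so its code arises by iterating the
  map on codes that adds \<open>One\<close>.\<close>

lemma tcomp_nat_term:
  assumes "tcomp n f"
  shows "tcomp n (\<lambda>xs. rterm_code (nat_term (f xs)))"
proof -
  let ?g = "\<lambda>c. prod_encode (3, prod_encode (c, prod_encode (2, 0)))"
  have "rterm_code (nat_term k) = (?g ^^ k) (prod_encode (1, 0))" for k
    by (induction k) auto
  moreover have "tcomp n (\<lambda>xs. (?g ^^ f xs) (prod_encode (1, 0)))"
    by (rule tcomp_iterate[where f = ?g])
      (auto intro!: tcomp_prod_encode tcomp_const tcomp_nth assms)
  ultimately show ?thesis by simp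
qed

text \<open>Variables of a system of equations over a number field: given quantities, parameters
  from the field, unknowns, and unknowns that are sought in the prime subfield.\<close>

datatype var = Given nat | Par nat | Unk nat | Rat nat

definition satisfies :: "('a, 'b) ring_scheme \<Rightarrow> (var \<Rightarrow> 'a) \<Rightarrow> (var rterm \<times> var rterm) list \<Rightarrow> bool" where
  "satisfies R v es \<longleftrightarrow>
     (\<forall>(s, t)\<in>set es. rterm_val R (map_rterm v s) = rterm_val R (map_rterm v t))"

definition vars :: "(var rterm \<times> var rterm) list \<Rightarrow> var set" where
  "vars es = (\<Union>(s, t)\<in>set es. consts_of s \<union> consts_of t)"

lemma finite_vars: "finite (vars es)"
  unfolding vars_def by (auto simp: finite_consts_of)

lemma satisfies_cong:
  assumes "\<And>x. x \<in> vars es \<Longrightarrow> v x = w x"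
  shows "satisfies R v es \<longleftrightarrow> satisfies R w es"
proof -
  have "map_rterm v s = map_rterm w s \<and> map_rterm v t = map_rterm w t" if "(s, t) \<in> set es" for s t
    using assms that unfolding vars_def by (force intro!: rterm.map_cong0)
  then show ?thesis unfolding satisfies_def by (metis (no_types, lifting) case_prodD case_prodI2)
qed

text \<open>\<open>subfield_Q\<close> is supplied by the Galois hypothesis when the locale is
  instantiated.\<close>

locale computable_number_field = Ring.field K for K :: "nat ring" (structure) +
  fixes Q :: "nat set"
  defines "Q \<equiv> prime_subfield K"
  assumes number_field: "number_field K"
    and computable: "computable_structure K"
    and subfield_Q: "subfield Q K"
begin

lemma Q_carrier: "Q \<subseteq> carrier K"
  using subfieldE(3)[OF subfield_Q] .

lemma rterm_val_closed: "consts_of t \<subseteq> carrier K \<Longrightarrow> rterm_val K t \<in> carrier K"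
  by (induction t) auto

section \<open>A computable enumeration of the rationals\<close>

lemma prime_subfield_iso: "\<exists>h. h \<in> ring_iso (ring_of_type_algebra :: rat ring) (K\<lparr>carrier := Q\<rparr>)"
  using number_field unfolding number_field_def Q_def is_ring_iso_def by blast

text \<open>The rational solving \<open>(s + 1) z + a = b\<close> is \<open>(b - a) / (s + 1)\<close>.\<close>

lemma rat_equation:
  shows "\<exists>z\<in>Q. rterm_val K (nat_term (Suc s)) \<otimes> z \<oplus> rterm_val K (nat_term a) = rterm_val K (nat_term b)"
    and "z \<in> Q \<Longrightarrow> \<exists>s a b. rterm_val K (nat_term (Suc s)) \<otimes> z \<oplus> rterm_val K (nat_term a)
      = rterm_val K (nat_term b)"
    and "rterm_val K (nat_term (Suc s)) \<noteq> \<zero>"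
proof -
  obtain h where h: "h \<in> ring_iso (ring_of_type_algebra :: rat ring) (K\<lparr>carrier := Q\<rparr>)"
    using prime_subfield_iso by blast
  have Q: "h r \<in> Q" and mult: "h (r * r') = h r \<otimes> h r'" and add: "h (r + r') = h r \<oplus> h r'" and one: "h 1 = \<one>" for r r'
    using ring_iso_memE[OF h] by (auto simp: ring_of_type_algebra_def)
  have bij: "bij_betw h UNIV Q"
    using ring_iso_memE(5)[OF h] by (simp add: ring_of_type_algebra_def)
  \<comment> \<open>A ring isomorphism is specified through sums, products and the unit, so zero is
    recognised as the additive idempotent.\<close>
  have "h 0 \<oplus> h 0 = h 0" using add[of 0 0] by simp
  then have zero: "h 0 = \<zero>"
    using Q[of 0] Q_carrier by (metis r_neg1 l_neg add.inv_closed subsetD add.r_cancel_one)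
  have h_nat: "rterm_val K (nat_term n) = h (of_nat n)" for n
    by (induction n) (auto simp: zero add one add.commute[of _ "1::rat"] a_comm Q[THEN Q_carrier[THEN subsetD]])
  show "\<exists>z\<in>Q. rterm_val K (nat_term (Suc s)) \<otimes> z \<oplus> rterm_val K (nat_term a) = rterm_val K (nat_term b)"
  proof (intro bexI[of _ "h ((of_nat b - of_nat a) / of_nat (Suc s))"] Q)
    have "of_nat (Suc s) * ((of_nat b - of_nat a) / of_nat (Suc s)) + of_nat a = (of_nat b :: rat)"
      by (simp del: of_nat_Suc)
    then show "rterm_val K (nat_term (Suc s)) \<otimes> h ((of_nat b - of_nat a) / of_nat (Suc s))
        \<oplus> rterm_val K (nat_term a) = rterm_val K (nat_term b)"
      unfolding h_nat by (metis mult add)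
  qed
  show "rterm_val K (nat_term (Suc s)) \<noteq> \<zero>"
  proof
    assume "rterm_val K (nat_term (Suc s)) = \<zero>"
    then have "h (of_nat (Suc s)) = h 0" unfolding h_nat zero .
    then have "of_nat (Suc s) = (0 :: rat)" using bij unfolding bij_betw_def inj_def by blast
    then show False by (simp del: of_nat_Suc)
  qed
  assume "z \<in> Q"
  then obtain r where r: "z = h r" using bij unfolding bij_betw_def by blast
  obtain p q :: int where pq: "r = of_int p / of_int q" "q > 0"
    by (metis quotient_of_div quotient_of_denom_pos surj_pair)
  \<comment> \<open>For \<open>r = p / q\<close> the witnesses are \<open>s = q - 1\<close>,
    \<open>a = nat (- p)\<close> and \<open>b = nat p\<close>. The numerator is a difference of
    natural numbers because the ring language has no minus sign.\<close>
  have 1: "(of_nat (Suc (nat q - 1)) :: rat) = of_int q" using pq(2) by simp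
  have 2: "(of_nat (nat p) :: rat) = of_int p + of_nat (nat (- p))" by simp
  have "of_nat (Suc (nat q - 1)) * r + of_nat (nat (- p)) = of_nat (nat p)"
    unfolding 1 2 using pq by simp
  then show "\<exists>s a b. rterm_val K (nat_term (Suc s)) \<otimes> z \<oplus> rterm_val K (nat_term a)
      = rterm_val K (nat_term b)"
    unfolding h_nat r by (metis mult add)
qed

text \<open>A triple \<open>(s, a, b)\<close> determines its rational, since \<open>s + 1\<close> is
  nonzero in \<open>K\<close>. A search through the domain of \<open>K\<close> therefore computes
  the rational from the triple, and every rational arises in this way.\<close>

lemma rat_enumeration: "\<exists>e. tcomp 1 (\<lambda>xs. e (xs ! 0)) \<and> range e = Q"
proof -
  let ?lhs = "\<lambda>t z. Plus (Times (nat_term (Suc (proj_code 0 t))) (Const z)) (nat_term (proj_code 1 t))"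
  let ?rhs = "\<lambda>t. nat_term (proj_code 2 t) :: nat rterm"
  define P where "P t z \<longleftrightarrow> consts_of (?lhs t z) \<union> consts_of (?rhs t) \<subseteq> carrier K
    \<and> rterm_val K (?lhs t z) = rterm_val K (?rhs t)" for t z
  define d :: "nat list \<Rightarrow> nat" where "d = (\<lambda>xs. if P (xs ! 1) (xs ! 0) then 0 else 1)"
  define e where "e t = (LEAST z. d [z, t] = 0)" for t
  have uniq: "z = z'" if "P t z" "P t z'" for t z z'
  proof -
    define c a where "c = rterm_val K (nat_term (Suc (proj_code 0 t)))"
      and "a = rterm_val K (nat_term (proj_code 1 t))"
    have ca: "c \<in> carrier K" "a \<in> carrier K" "c \<noteq> \<zero>"
      unfolding c_def a_def using rat_equation(3) by (auto intro!: rterm_val_closed simp del: nat_term.simps)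
    have z: "z \<in> carrier K" "z' \<in> carrier K" and "c \<otimes> z \<oplus> a = c \<otimes> z' \<oplus> a"
      using that unfolding P_def c_def a_def by (auto simp del: nat_term.simps)
    then have "c \<otimes> z = c \<otimes> z'" using ca by simp
    then show ?thesis using ca z by (simp add: m_lcancel)
  qed
  have ex: "\<exists>z\<in>Q. P t z" for t
    using rat_equation(1)[of "proj_code 0 t" "proj_code 1 t" "proj_code 2 t"] Q_carrier
    unfolding P_def by (auto simp del: nat_term.simps)
  have e: "P t (e t)" "e t \<in> Q" for t
  proof -
    obtain z where "z \<in> Q" "P t z" using ex by blast
    then have "d [z, t] = 0" by (simp add: d_def)
    then have "d [e t, t] = 0"
      unfolding e_def by (rule LeastI[of "\<lambda>z. d [z, t] = 0"])
    then show "P t (e t)" by (simp add: d_def split: if_splits)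
    with \<open>z \<in> Q\<close> \<open>P t z\<close> show "e t \<in> Q" using uniq by metis
  qed
  have "Q \<subseteq> range e"
  proof
    fix z assume z: "z \<in> Q"
    then obtain s a b where *: "rterm_val K (nat_term (Suc s)) \<otimes> z \<oplus> rterm_val K (nat_term a)
      = rterm_val K (nat_term b)" using rat_equation(2) by blast
    obtain t where t: "\<forall>j<3. proj_code j t = [s, a, b] ! j" using proj_code_surj by blast
    have "proj_code 0 t = s" "proj_code 1 t = a" "proj_code 2 t = b"
      using t[rule_format, of 0] t[rule_format, of 1] t[rule_format, of 2] by (simp_all add: numeral_2_eq_2)
    then have "P t z" using * z Q_carrier unfolding P_def by (auto simp del: nat_term.simps)
    then show "z \<in> range e" using e uniq by blast
  qed
  moreover have "tcomp 1 (\<lambda>xs. e (xs ! 0))"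
  proof (rule tcomp_cong[OF tcomp_search])
    show "tcomp (Suc 1) d"
      unfolding d_def P_def
      by (rule tcomp_term_equation[OF computable])
        (auto simp del: nat_term.simps intro!: tcomp_prod_encode tcomp_const tcomp_nat_term tcomp_Suc tcomp_proj_code tcomp_nth)
  next
    fix xs :: "nat list" assume "length xs = 1"
    then show "\<exists>t. d (t # xs) = 0" using ex[of "xs ! 0"] unfolding d_def by auto
  next
    fix xs :: "nat list" assume "length xs = 1"
    then have "xs = [xs ! 0]" by (auto simp: length_Suc_conv)
    then show "(LEAST t. d (t # xs) = 0) = e (xs ! 0)" unfolding e_def by metis
  qed
  ultimately show ?thesis using e by (intro exI[of _ e]) auto
qed

text \<open>Total assignments \<open>a\<close> and \<open>q\<close> serve systems with any number of
  unknowns. Indices where a given function is undefined are excluded, since no search can start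
  there; the set thus becomes the exact domain of the search.\<close>

definition solvable :: "(nat \<rightharpoonup> nat) list \<Rightarrow> (var rterm \<times> var rterm) list \<Rightarrow> nat set" where
  "solvable \<phi>s es = {i. (\<forall>\<phi>\<in>set \<phi>s. i \<in> dom \<phi>) \<and> (\<exists>a q. range a \<subseteq> carrier K \<and> range q \<subseteq> Q \<and>
      satisfies K (case_var (\<lambda>j. the ((\<phi>s ! j) i)) id a q) es)}"

text \<open>The solutions are found by searching through the codes of all candidate tuples.\<close>

lemma solve:
  fixes \<phi>s :: "(nat \<rightharpoonup> nat) list" and es :: "(var rterm \<times> var rterm) list"
  assumes \<phi>s: "\<And>\<phi>. \<phi> \<in> set \<phi>s \<Longrightarrow> partial_computable \<phi> \<and> ran \<phi> \<subseteq> carrier K"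
    and Given: "\<And>j. Given j \<in> vars es \<Longrightarrow> j < length \<phi>s"
    and Par: "\<And>c. Par c \<in> vars es \<Longrightarrow> c \<in> carrier K"
  obtains A B :: "nat \<Rightarrow> nat \<rightharpoonup> nat" where
    "\<And>j. partial_computable (A j)" "\<And>j. partial_computable (B j)"
    "\<And>j. dom (A j) = solvable \<phi>s es" "\<And>j. dom (B j) = solvable \<phi>s es"
    "\<And>j. ran (A j) \<subseteq> carrier K" "\<And>j. ran (B j) \<subseteq> Q"
    "\<And>i. i \<in> solvable \<phi>s es \<Longrightarrow> satisfies K
       (case_var (\<lambda>j. the ((\<phi>s ! j) i)) id (\<lambda>j. the (A j i)) (\<lambda>j. the (B j i))) es"
proof -
  define W where "W = solvable \<phi>s es"
  note W_def = W_def[unfolded solvable_def]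
  obtain e where e: "tcomp 1 (\<lambda>xs. e (xs ! 0))" "range e = Q"
    using rat_enumeration by blast
  define k where "k = length \<phi>s"
  have "finite {j. Unk j \<in> vars es \<or> Rat j \<in> vars es}"
    by (rule finite_subset[of _ "case_var id id id id ` vars es"]) (force simp: finite_vars)+
  then obtain m where "{j. Unk j \<in> vars es \<or> Rat j \<in> vars es} \<subseteq> {..<m}"
    using finite_nat_bounded by blast
  then have m: "\<And>j. Unk j \<in> vars es \<Longrightarrow> j < Suc m" "\<And>j. Rat j \<in> vars es \<Longrightarrow> j < Suc m"
    by force+
  \<comment> \<open>The trivial equations leave the solutions unchanged but make the diagram test
    force the values of the first \<open>Suc m\<close> unknowns into the domain of \<open>K\<close>,
    including unknowns absent from \<open>es\<close>. Since \<open>Suc m\<close> is positive,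
    unknown 0 is always among them.\<close>
  define es' where "es' = es @ map (\<lambda>j. (Const (Unk j), Const (Unk j))) [0..<Suc m]"
  have vars_es': "vars es' = vars es \<union> Unk ` {..<Suc m}"
    unfolding es'_def vars_def by auto
  have sat_es': "satisfies K v es' \<longleftrightarrow> satisfies K v es" for v
    unfolding es'_def satisfies_def by auto
  \<comment> \<open>Position 0 of \<open>ys\<close> holds the candidate, a pair of tuple codes: one
    for the field unknowns, one for the indices under \<open>e\<close> of the rational unknowns. The
    given values follow from position 1 on.\<close>
  define V where "V = (\<lambda>ys. case_var (\<lambda>j. ys ! Suc j) id (\<lambda>j. proj_code j (fst (prod_decode (ys ! 0))))
      (\<lambda>j. e (proj_code j (snd (prod_decode (ys ! 0))))))"
  define D where "D ys = (\<Sum>(s, t)\<leftarrow>es'. if consts_of (map_rterm (V ys) s) \<union> consts_of (map_rterm (V ys) t) \<subseteq> carrier K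
      \<and> rterm_val K (map_rterm (V ys) s) = rterm_val K (map_rterm (V ys) t) then 0 else 1 :: nat)" for ys
  have D_0: "D ys = 0 \<longleftrightarrow> V ys ` vars es' \<subseteq> carrier K \<and> satisfies K (V ys) es" for ys
  proof -
    have "D ys = 0 \<longleftrightarrow> (\<forall>(s, t)\<in>set es'. consts_of (map_rterm (V ys) s) \<union> consts_of (map_rterm (V ys) t) \<subseteq> carrier K
      \<and> rterm_val K (map_rterm (V ys) s) = rterm_val K (map_rterm (V ys) t))"
      unfolding D_def by (rule sum_list_indicator_eq_0)
    also have "\<dots> \<longleftrightarrow> V ys ` vars es' \<subseteq> carrier K \<and> satisfies K (V ys) es'"
      unfolding satisfies_def vars_def by (fastforce simp: rterm.set_map)
    finally show ?thesis unfolding sat_es' .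
  qed
  have tcomp_V: "tcomp (Suc k) (\<lambda>ys. V ys x)" if "x \<in> vars es'" for x
  proof (cases x)
    case (Given j)
    then have "j < k" using that assms(2) unfolding k_def vars_es' by auto
    then show ?thesis unfolding V_def Given by (simp add: tcomp_nth)
  next
    case (Rat j)
    then show ?thesis unfolding V_def
      by (auto intro!: tcomp_comp1[OF e(1)] tcomp_proj_code tcomp_prod_decode tcomp_nth)
  qed (auto simp: V_def intro!: tcomp_const tcomp_proj_code tcomp_prod_decode tcomp_nth)
  have "tcomp (Suc k) D"
    unfolding D_def
  proof (rule tcomp_sum_list)
    fix st assume "st \<in> set es'"
    moreover obtain s t where st: "st = (s, t)" by (cases st)
    ultimately have "consts_of s \<subseteq> vars es'" "consts_of t \<subseteq> vars es'"
      unfolding vars_def by fastforce+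
    then show "tcomp (Suc k) (\<lambda>ys. case st of (s, t) \<Rightarrow>
        if consts_of (map_rterm (V ys) s) \<union> consts_of (map_rterm (V ys) t) \<subseteq> carrier K
        \<and> rterm_val K (map_rterm (V ys) s) = rterm_val K (map_rterm (V ys) t) then 0 else 1)"
      unfolding st prod.case
      by (intro tcomp_term_equation[OF computable] tcomp_rterm_code tcomp_V) auto
  qed
  note search = pcomp_search[OF this]
  define ins where "ins i = map (\<lambda>\<phi>. the (\<phi> i)) \<phi>s" for i
  define T where "T i = (if (\<forall>\<phi>\<in>set \<phi>s. \<phi> i \<noteq> None) \<and> (\<exists>t. D (t # ins i) = 0)
      then Some (LEAST t. D (t # ins i) = 0) else None)" for i
  have T: "partial_computable T"
    unfolding partial_computable_iff_pcomp
  proof (rule pcomp_cong[OF pcomp_comp])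
    show "pcomp (length (map (\<lambda>\<phi> xs. \<phi> (hd xs)) \<phi>s))
       (\<lambda>xs. if \<exists>t. D (t # xs) = 0 then Some (LEAST t. D (t # xs) = 0) else None)"
      using search by (simp add: k_def)
    show "pcomp 1 g" if "g \<in> set (map (\<lambda>\<phi> xs. \<phi> (hd xs)) \<phi>s)" for g
      using that \<phi>s by (auto simp: partial_computable_iff_pcomp)
    fix xs :: "nat list"
    show "(if \<forall>g\<in>set (map (\<lambda>\<phi> xs. \<phi> (hd xs)) \<phi>s). g xs \<noteq> None
        then if \<exists>t. D (t # map (\<lambda>g. the (g xs)) (map (\<lambda>\<phi> xs. \<phi> (hd xs)) \<phi>s)) = 0
          then Some (LEAST t. D (t # map (\<lambda>g. the (g xs)) (map (\<lambda>\<phi> xs. \<phi> (hd xs)) \<phi>s)) = 0)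
          else None else None) = T (hd xs)"
      unfolding T_def ins_def by (simp add: comp_def)
  qed
  have T_D: "D (t # ins i) = 0" if "T i = Some t" for i t
    using that unfolding T_def by (auto split: if_splits intro: LeastI)
  let ?v = "\<lambda>i a q. case_var (\<lambda>j. the ((\<phi>s ! j) i)) id a q"
  have V_ins: "V (t # ins i) x = ?v i (\<lambda>j. proj_code j (fst (prod_decode t)))
      (\<lambda>j. e (proj_code j (snd (prod_decode t)))) x" if "x \<in> vars es" for t i x
    using that Given unfolding V_def ins_def by (cases x) auto
  have dom_T: "dom T = W"
  proof (intro Set.set_eqI iffI)
    fix i assume "i \<in> dom T"
    then obtain t where t: "T i = Some t" by blast
    \<comment> \<open>Indices beyond the tested unknowns are redirected to unknown 0, whose value is
      known to lie in the domain. The functions \<open>A j\<close> use the same default.\<close>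
    define a where "a j = proj_code (if j < Suc m then j else 0) (fst (prod_decode t))" for j
    define q where "q j = e (proj_code j (snd (prod_decode t)))" for j
    from T_D[OF t] have sat: "satisfies K (V (t # ins i)) es" and c: "V (t # ins i) ` vars es' \<subseteq> carrier K"
      unfolding D_0 by auto
    have "V (t # ins i) (Unk j) \<in> carrier K" if "j < Suc m" for j
      using c that unfolding vars_es' by auto
    then have "range a \<subseteq> carrier K" unfolding a_def V_def by auto
    moreover have "range q \<subseteq> Q" unfolding q_def using e(2) by auto
    moreover have "satisfies K (?v i a q) es"
    proof (rule satisfies_cong[THEN iffD1, OF _ sat])
      fix x assume "x \<in> vars es"
      then show "V (t # ins i) x = ?v i a q x"
        unfolding V_ins[OF \<open>x \<in> vars es\<close>] a_def q_def using m by (cases x) auto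
    qed
    moreover have "\<forall>\<phi>\<in>set \<phi>s. i \<in> dom \<phi>" using t unfolding T_def by (auto split: if_splits)
    ultimately show "i \<in> W" unfolding W_def by blast
  next
    fix i assume "i \<in> W"
    then obtain a q where i: "\<forall>\<phi>\<in>set \<phi>s. i \<in> dom \<phi>" and a: "range a \<subseteq> carrier K" and q: "range q \<subseteq> Q"
      and sat: "satisfies K (?v i a q) es" unfolding W_def by blast
    obtain t1 where t1: "\<forall>j<Suc m. proj_code j t1 = a j" using proj_code_surj by blast
    have "\<forall>j. \<exists>u. e u = q j" using q e(2) by (metis imageE range_subsetD)
    then obtain u where u: "\<And>j. e (u j) = q j" by metis
    obtain t2 where t2: "\<forall>j<Suc m. proj_code j t2 = u j" using proj_code_surj by blast
    define t where "t = prod_encode (t1, t2)"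
    have V: "V (t # ins i) x = ?v i a q x" if "x \<in> vars es" for x
      unfolding V_ins[OF that] t_def using that t1 t2 u m by (cases x) auto
    have "V (t # ins i) x \<in> carrier K" if "x \<in> vars es'" for x
    proof (cases "x \<in> vars es")
      case True
      have "the ((\<phi>s ! j) i) \<in> carrier K" if "j < length \<phi>s" for j
        using \<phi>s[OF nth_mem[OF that]] i[rule_format, OF nth_mem[OF that]] by (auto simp: ran_def)
      moreover have "a j \<in> carrier K" "q j \<in> carrier K" for j
        using a q Q_carrier by blast+
      ultimately show ?thesis
        unfolding V[OF True] using True Given Par by (cases x) auto
    next
      case False
      then show ?thesis using that t1 a unfolding vars_es' V_def t_def by auto
    qed
    moreover have "satisfies K (V (t # ins i)) es"
      using satisfies_cong[THEN iffD2, OF V sat] .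
    ultimately have "D (t # ins i) = 0" unfolding D_0 by auto
    then show "i \<in> dom T" unfolding T_def using i by auto
  qed
  have W: "W = solvable \<phi>s es" unfolding W_def solvable_def ..
  define A where "A j i = map_option (\<lambda>t. proj_code (if j < Suc m then j else 0) (fst (prod_decode t))) (T i)" for j i
  define B where "B j i = map_option (\<lambda>t. e (proj_code j (snd (prod_decode t)))) (T i)" for j i
  show thesis
  proof (rule that, unfold W[symmetric])
    show "partial_computable (A j)" for j
      unfolding A_def
      by (rule partial_computable_map[OF _ T]) (intro tcomp_proj_code tcomp_prod_decode tcomp_nth, simp)
    show "partial_computable (B j)" for j
      unfolding B_def
      by (rule partial_computable_map[OF _ T]) (intro tcomp_comp1[OF e(1)] tcomp_proj_code tcomp_prod_decode tcomp_nth, simp)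
    show "dom (A j) = W" "dom (B j) = W" for j
      unfolding dom_T[symmetric] A_def B_def by auto
    show "ran (B j) \<subseteq> Q" for j
      unfolding B_def ran_def using e(2) by auto
    show "ran (A j) \<subseteq> carrier K" for j
    proof
      fix y assume "y \<in> ran (A j)"
      then obtain i t where "T i = Some t" and y: "y = proj_code (if j < Suc m then j else 0) (fst (prod_decode t))"
        unfolding ran_def A_def by auto
      from T_D[OF this(1)] have "V (t # ins i) (Unk (if j < Suc m then j else 0)) \<in> carrier K"
        unfolding D_0 vars_es' by auto
      then show "y \<in> carrier K" unfolding y V_def by simp
    qed
    fix i assume "i \<in> W"
    then obtain t where t: "T i = Some t" using dom_T by blast
    then have sat: "satisfies K (V (t # ins i)) es" using T_D D_0 by blast
    show "satisfies K (?v i (\<lambda>j. the (A j i)) (\<lambda>j. the (B j i))) es"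
    proof (rule satisfies_cong[THEN iffD1, OF _ sat])
      fix x assume "x \<in> vars es"
      then show "V (t # ins i) x = ?v i (\<lambda>j. the (A j i)) (\<lambda>j. the (B j i)) x"
        unfolding V_ins[OF \<open>x \<in> vars es\<close>] A_def B_def t using m by (cases x) auto
    qed
  qed
qed

end

section \<open>The cohesive power of a number field\<close>

lemma the_in_ran: "i \<in> dom f \<Longrightarrow> the (f i) \<in> ran f"
  by (auto intro: ranI)

locale cohesive_number_field = computable_number_field +
  fixes C :: "nat set"
  assumes cohesive: "cohesive C"
begin

abbreviation ae :: "nat filter" where "ae \<equiv> inf cofinite (principal C)"

abbreviation funs :: "(nat \<rightharpoonup> nat) set" where "funs \<equiv> cohesive_funs C (carrier K)"

abbreviation cl :: "(nat \<rightharpoonup> nat) \<Rightarrow> (nat \<rightharpoonup> nat) set" where "cl \<equiv> cohesive_class C K"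

abbreviation P :: "(nat \<rightharpoonup> nat) set ring" where "P \<equiv> cohesive_power C K"

abbreviation F :: "(nat \<rightharpoonup> nat) set set" where "F \<equiv> cohesive_subpower C K Q"

definition diag :: "nat \<Rightarrow> (nat \<rightharpoonup> nat) set" where "diag c = cl (\<lambda>_. Some c)"

lemma infinite_C: "infinite C"
  using cohesive unfolding cohesive_def by blast

text \<open>Almost inclusion is convergence along the filter \<open>ae\<close>, so that finite
  exceptional sets are absorbed by reasoning about eventualities.\<close>

lemma almost_subset_iff: "C \<subseteq>\<^sup>* S \<longleftrightarrow> (\<forall>\<^sub>F i in ae. i \<in> S)"
proof -
  have "C - S = {i. \<not> (i \<in> C \<longrightarrow> i \<in> S)}" by auto
  then show ?thesis
    unfolding almost_subset_def eventually_inf_principal eventually_cofinite by simp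
qed

lemma funsE:
  assumes "\<phi> \<in> cohesive_funs C A"
  shows "partial_computable \<phi>" "ran \<phi> \<subseteq> A" "\<forall>\<^sub>F i in ae. i \<in> dom \<phi>"
  using assms unfolding cohesive_funs_def almost_subset_iff by auto

lemma subfuns: "\<phi> \<in> cohesive_funs C Q \<Longrightarrow> \<phi> \<in> funs"
  using Q_carrier unfolding cohesive_funs_def by auto

text \<open>Plain equality of options also holds where both functions are undefined, but for \<phi>
  in \<open>funs\<close> this adds only finitely many points of \<open>C\<close>.\<close>

lemma mem_cl:
  assumes "\<phi> \<in> funs"
  shows "\<psi> \<in> cl \<phi> \<longleftrightarrow> \<psi> \<in> funs \<and> (\<forall>\<^sub>F i in ae. \<phi> i = \<psi> i)"
proof -
  have "(\<forall>\<^sub>F i in ae. \<exists>a. \<phi> i = Some a \<and> \<psi> i = Some a) \<longleftrightarrow> (\<forall>\<^sub>F i in ae. \<phi> i = \<psi> i)"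
    by (rule eventually_subst) (use funsE(3)[OF assms] in \<open>auto elim!: eventually_mono\<close>)
  then show ?thesis unfolding cohesive_class_def almost_subset_iff by simp
qed

lemma cl_eq:
  assumes "\<phi> \<in> funs" "\<psi> \<in> funs"
  shows "cl \<phi> = cl \<psi> \<longleftrightarrow> (\<forall>\<^sub>F i in ae. \<phi> i = \<psi> i)"
proof
  assume "cl \<phi> = cl \<psi>"
  moreover have "\<psi> \<in> cl \<psi>" unfolding mem_cl[OF assms(2)] using assms by simp
  ultimately show "\<forall>\<^sub>F i in ae. \<phi> i = \<psi> i" using mem_cl[OF assms(1)] by blast
next
  assume *: "\<forall>\<^sub>F i in ae. \<phi> i = \<psi> i"
  show "cl \<phi> = cl \<psi>"
    unfolding Set.set_eq_iff mem_cl[OF assms(1)] mem_cl[OF assms(2)]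
    using * by (auto elim: eventually_elim2)
qed

lemma cl_self: "\<phi> \<in> funs \<Longrightarrow> \<phi> \<in> cl \<phi>"
  by (simp add: mem_cl)

lemma carrier_P: "carrier P = cl ` funs"
  by (simp add: cohesive_power_def)

lemma const_funs: "c \<in> A \<Longrightarrow> (\<lambda>_. Some c) \<in> cohesive_funs C A"
  unfolding cohesive_funs_def almost_subset_def by (auto simp: partial_computable_const ran_def)

lemma diag_closed: "c \<in> carrier K \<Longrightarrow> diag c \<in> carrier P"
  unfolding diag_def carrier_P using const_funs by blast

lemma F_carrier: "F \<subseteq> carrier P"
  unfolding cohesive_subpower_def carrier_P using subfuns by blast

lemma diag_F: "c \<in> Q \<Longrightarrow> diag c \<in> F"
  unfolding diag_def cohesive_subpower_def using const_funs by blast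

text \<open>\<open>Unk 0\<close> plays the role of the output. Solvability for all arguments gives
  the search the right domain, and uniqueness of \<open>a 0\<close> gives it the right value; the
  auxiliary unknowns may have many solutions.\<close>

lemma partial_computable_definable:
  fixes \<phi>s :: "(nat \<rightharpoonup> nat) list"
  assumes \<phi>s: "\<And>\<phi>. \<phi> \<in> set \<phi>s \<Longrightarrow> partial_computable \<phi> \<and> ran \<phi> \<subseteq> carrier K"
    and Given: "\<And>j. Given j \<in> vars es \<Longrightarrow> j < length \<phi>s"
    and Par: "\<And>c. Par c \<in> vars es \<Longrightarrow> c \<in> carrier K"
    and ex: "\<And>x. (\<And>j. j < length \<phi>s \<Longrightarrow> x j \<in> carrier K) \<Longrightarrow>
      \<exists>a q. range a \<subseteq> carrier K \<and> range q \<subseteq> Q \<and> satisfies K (case_var x id a q) es"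
    and uniq: "\<And>x a q. (\<And>j. j < length \<phi>s \<Longrightarrow> x j \<in> carrier K) \<Longrightarrow> range a \<subseteq> carrier K \<Longrightarrow> range q \<subseteq> Q \<Longrightarrow>
      satisfies K (case_var x id a q) es \<Longrightarrow> a 0 = f x"
  shows "partial_computable (\<lambda>i. if \<forall>\<phi>\<in>set \<phi>s. i \<in> dom \<phi> then Some (f (\<lambda>j. the ((\<phi>s ! j) i))) else None)"
proof -
  let ?W = "solvable \<phi>s es"
  obtain A B :: "nat \<Rightarrow> nat \<rightharpoonup> nat" where
    A: "\<And>j. partial_computable (A j)" "\<And>j. partial_computable (B j)" and dom: "\<And>j. dom (A j) = ?W" "\<And>j. dom (B j) = ?W"
    and ran: "\<And>j. ran (A j) \<subseteq> carrier K" "\<And>j. ran (B j) \<subseteq> Q"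
    and sat: "\<And>i. i \<in> ?W \<Longrightarrow> satisfies K
       (case_var (\<lambda>j. the ((\<phi>s ! j) i)) id (\<lambda>j. the (A j i)) (\<lambda>j. the (B j i))) es"
    using solve[of \<phi>s es, OF \<phi>s Given Par] by blast
  have carr: "the ((\<phi>s ! j) i) \<in> carrier K" if "\<forall>\<phi>\<in>set \<phi>s. i \<in> dom \<phi>" "j < length \<phi>s" for i j
    using \<phi>s[OF nth_mem[OF that(2)]] that(1)[rule_format, OF nth_mem[OF that(2)]] by (auto simp: ran_def)
  have W: "?W = {i. \<forall>\<phi>\<in>set \<phi>s. i \<in> dom \<phi>}"
  proof (intro Set.set_eqI iffI)
    fix i assume "i \<in> {i. \<forall>\<phi>\<in>set \<phi>s. i \<in> dom \<phi>}"
    then have d: "\<forall>\<phi>\<in>set \<phi>s. i \<in> dom \<phi>" by simp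
    from ex[of "\<lambda>j. the ((\<phi>s ! j) i)", OF carr[OF d]] d show "i \<in> ?W" unfolding solvable_def by simp
  qed (simp add: solvable_def)
  have "A 0 i = (if \<forall>\<phi>\<in>set \<phi>s. i \<in> dom \<phi> then Some (f (\<lambda>j. the ((\<phi>s ! j) i))) else None)" for i
  proof (cases "i \<in> ?W")
    case True
    then have d: "\<forall>\<phi>\<in>set \<phi>s. i \<in> dom \<phi>" unfolding W by simp
    have "the (A 0 i) = f (\<lambda>j. the ((\<phi>s ! j) i))"
    proof (rule uniq[OF _ _ _ sat[OF True]])
      show "the ((\<phi>s ! j) i) \<in> carrier K" if "j < length \<phi>s" for j
        using carr[OF d that] .
      show "range (\<lambda>j. the (A j i)) \<subseteq> carrier K"
        using the_in_ran[of i "A _"] ran(1) True dom(1) by blast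
      show "range (\<lambda>j. the (B j i)) \<subseteq> Q"
        using the_in_ran[of i "B _"] ran(2) True dom(2) by blast
    qed
    moreover have "A 0 i \<noteq> None" using True dom(1) by blast
    ultimately show ?thesis using d by auto
  next
    case False
    then show ?thesis using dom(1)[of 0] unfolding W by auto
  qed
  then show ?thesis using A(1)[of 0] by presburger
qed

text \<open>The value of a term is found as the solution of \<open>Unk 0 = t\<close>. This is how
  the operations of \<open>K\<close> become computable functions.\<close>

lemma partial_computable_term:
  assumes "\<And>\<phi>. \<phi> \<in> set \<phi>s \<Longrightarrow> partial_computable \<phi> \<and> ran \<phi> \<subseteq> carrier K"
    and "consts_of t \<subseteq> Given ` {..<length \<phi>s}"
  shows "partial_computable (\<lambda>i. if \<forall>\<phi>\<in>set \<phi>s. i \<in> dom \<phi>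
    then Some (rterm_val K (map_rterm (case_var (\<lambda>j. the ((\<phi>s ! j) i)) id id id) t)) else None)"
proof (rule partial_computable_definable[where es = "[(Const (Unk 0), t)]" and
      f = "\<lambda>x. rterm_val K (map_rterm (case_var x id id id) t)", OF assms(1)])
  have eq: "map_rterm (case_var x id a q) t = map_rterm (case_var x id id id) t" for x a q
    using assms(2) by (intro rterm.map_cong0) auto
  fix x :: "nat \<Rightarrow> nat" assume x: "\<And>j. j < length \<phi>s \<Longrightarrow> x j \<in> carrier K"
  have "rterm_val K (map_rterm (case_var x id id id) t) \<in> carrier K"
    using assms(2) x by (intro rterm_val_closed) (auto simp: rterm.set_map)
  moreover have "satisfies K (case_var x id (\<lambda>_. rterm_val K (map_rterm (case_var x id id id) t)) (\<lambda>_. \<zero>))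
      [(Const (Unk 0), t)]"
    unfolding satisfies_def
    using eq[of x "\<lambda>_. rterm_val K (map_rterm (case_var x id id id) t)" "\<lambda>_. \<zero>"] by simp
  ultimately show "\<exists>a q. range a \<subseteq> carrier K \<and> range q \<subseteq> Q \<and> satisfies K (case_var x id a q) [(Const (Unk 0), t)]"
    using subringE(2)[OF subfieldE(1)[OF subfield_Q]] by (intro exI conjI) auto
  fix a q assume "satisfies K (case_var x id a q) [(Const (Unk 0), t)]"
  then show "a 0 = rterm_val K (map_rterm (case_var x id id id) t)"
    by (simp add: satisfies_def eq[of x a q])
qed (use assms(2) in \<open>auto simp: vars_def\<close>)

lemma pointwise_funs:
  assumes "\<phi> \<in> funs" "\<psi> \<in> funs"
  shows "pointwise (\<oplus>) \<phi> \<psi> \<in> funs" "pointwise (\<otimes>) \<phi> \<psi> \<in> funs"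
proof -
  have inp: "\<chi> \<in> set [\<phi>, \<psi>] \<Longrightarrow> partial_computable \<chi> \<and> ran \<chi> \<subseteq> carrier K" for \<chi>
    using funsE(1,2)[OF assms(1)] funsE(1,2)[OF assms(2)] by auto
  have dom: "dom (pointwise f \<phi> \<psi>) = dom \<phi> \<inter> dom \<psi>" for f :: "nat \<Rightarrow> nat \<Rightarrow> nat"
    by (auto simp: pointwise_def split: option.splits)
  have ae: "\<forall>\<^sub>F i in ae. i \<in> dom \<phi> \<inter> dom \<psi>"
    using funsE(3)[OF assms(1)] funsE(3)[OF assms(2)] by (auto elim: eventually_elim2)
  have ran: "ran (pointwise f \<phi> \<psi>) \<subseteq> carrier K"
    if "\<And>a b. a \<in> carrier K \<Longrightarrow> b \<in> carrier K \<Longrightarrow> f a b \<in> carrier K" for f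
  proof
    fix c assume "c \<in> ran (pointwise f \<phi> \<psi>)"
    then obtain i a b where "\<phi> i = Some a" "\<psi> i = Some b" "c = f a b"
      by (auto simp: pointwise_def ran_def split: option.splits)
    then show "c \<in> carrier K"
      using that funsE(2)[OF assms(1)] funsE(2)[OF assms(2)] by (blast intro: ranI)
  qed
  have "partial_computable (pointwise (\<oplus>) \<phi> \<psi>)"
  proof -
    have "(\<lambda>i. if \<forall>\<phi>\<in>set [\<phi>, \<psi>]. i \<in> dom \<phi>
        then Some (rterm_val K (map_rterm (case_var (\<lambda>j. the (([\<phi>, \<psi>] ! j) i)) id id id)
          (Plus (Const (Given 0)) (Const (Given 1))))) else None) = pointwise (\<oplus>) \<phi> \<psi>"
      by (auto simp: pointwise_def fun_eq_iff split: option.splits)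
    then show ?thesis
      using partial_computable_term[of "[\<phi>, \<psi>]", OF inp, where t = "Plus (Const (Given 0)) (Const (Given 1))"] by auto
  qed
  then show "pointwise (\<oplus>) \<phi> \<psi> \<in> funs"
    unfolding cohesive_funs_def almost_subset_iff using ae ran by (auto simp: dom)
  have "partial_computable (pointwise (\<otimes>) \<phi> \<psi>)"
  proof -
    have "(\<lambda>i. if \<forall>\<phi>\<in>set [\<phi>, \<psi>]. i \<in> dom \<phi>
        then Some (rterm_val K (map_rterm (case_var (\<lambda>j. the (([\<phi>, \<psi>] ! j) i)) id id id)
          (Times (Const (Given 0)) (Const (Given 1))))) else None) = pointwise (\<otimes>) \<phi> \<psi>"
      by (auto simp: pointwise_def fun_eq_iff split: option.splits)
    then show ?thesis
      using partial_computable_term[of "[\<phi>, \<psi>]", OF inp, where t = "Times (Const (Given 0)) (Const (Given 1))"] by auto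
  qed
  then show "pointwise (\<otimes>) \<phi> \<psi> \<in> funs"
    unfolding cohesive_funs_def almost_subset_iff using ae ran by (auto simp: dom)
qed

section \<open>Operations on classes and transfer of equations\<close>

lemma union_cl:
  assumes "\<And>\<phi> \<psi>. \<phi> \<in> funs \<Longrightarrow> \<psi> \<in> funs \<Longrightarrow> pointwise f \<phi> \<psi> \<in> funs" "\<phi> \<in> funs" "\<psi> \<in> funs"
  shows "(\<Union>\<phi>'\<in>cl \<phi>. \<Union>\<psi>'\<in>cl \<psi>. cl (pointwise f \<phi>' \<psi>')) = cl (pointwise f \<phi> \<psi>)"
proof -
  have "cl (pointwise f \<phi>' \<psi>') = cl (pointwise f \<phi> \<psi>)" if "\<phi>' \<in> cl \<phi>" "\<psi>' \<in> cl \<psi>" for \<phi>' \<psi>'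
  proof -
    from that have *: "\<phi>' \<in> funs" "\<psi>' \<in> funs" "\<forall>\<^sub>F i in ae. \<phi> i = \<phi>' i" "\<forall>\<^sub>F i in ae. \<psi> i = \<psi>' i"
      using mem_cl assms by auto
    have "\<forall>\<^sub>F i in ae. pointwise f \<phi>' \<psi>' i = pointwise f \<phi> \<psi> i"
      using *(3,4) by eventually_elim (auto simp: pointwise_def split: option.splits)
    then show ?thesis using cl_eq assms * by blast
  qed
  then show ?thesis using cl_self[OF assms(2)] cl_self[OF assms(3)] by blast
qed

lemma P_ops:
  assumes "\<phi> \<in> funs" "\<psi> \<in> funs"
  shows "cl \<phi> \<oplus>\<^bsub>P\<^esub> cl \<psi> = cl (pointwise (\<oplus>) \<phi> \<psi>)"
    and "cl \<phi> \<otimes>\<^bsub>P\<^esub> cl \<psi> = cl (pointwise (\<otimes>) \<phi> \<psi>)"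
  using union_cl[OF pointwise_funs(1) assms] union_cl[OF pointwise_funs(2) assms]
  by (simp_all add: cohesive_power_def)

lemma P_zero_one: "\<zero>\<^bsub>P\<^esub> = diag \<zero>" "\<one>\<^bsub>P\<^esub> = diag \<one>"
  by (simp_all add: cohesive_power_def diag_def)

lemma diag_hom: "diag \<in> ring_hom K P"
proof (rule ring_hom_memI)
  fix a b assume ab: "a \<in> carrier K" "b \<in> carrier K"
  have "pointwise f (\<lambda>_. Some a) (\<lambda>_. Some b) = (\<lambda>_. Some (f a b))" for f :: "nat \<Rightarrow> nat \<Rightarrow> nat"
    by (simp add: pointwise_def)
  then show "diag (a \<otimes> b) = diag a \<otimes>\<^bsub>P\<^esub> diag b" "diag (a \<oplus> b) = diag a \<oplus>\<^bsub>P\<^esub> diag b"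
    using P_ops[OF const_funs const_funs, OF ab] by (simp_all add: diag_def)
qed (simp_all add: diag_closed P_zero_one)

lemma diag_inj: "inj_on diag (carrier K)"
proof (rule inj_onI)
  fix a b assume ab: "a \<in> carrier K" "b \<in> carrier K" "diag a = diag b"
  then have "\<forall>\<^sub>F i in ae. Some a = Some b"
    using cl_eq[OF const_funs const_funs] unfolding diag_def by blast
  then show "a = b"
    using infinite_C unfolding eventually_inf_principal eventually_cofinite by (cases "a = b") auto
qed

text \<open>The analogue of the theorem of Los for terms. The pointwise value is claimed only almost
  everywhere, because \<open>the\<close> is arbitrary where some \<Psi> is undefined.\<close>

lemma rterm_val_P:
  assumes "\<And>v. v \<in> consts_of t \<Longrightarrow> \<Psi> v \<in> funs"
  shows "\<exists>\<chi>\<in>funs. rterm_val P (map_rterm (\<lambda>v. cl (\<Psi> v)) t) = cl \<chi> \<and>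
    (\<forall>\<^sub>F i in ae. \<chi> i = Some (rterm_val K (map_rterm (\<lambda>v. the (\<Psi> v i)) t)))"
  using assms
proof (induction t)
  case (Const v)
  then have "\<Psi> v \<in> funs" by simp
  moreover from funsE(3)[OF this] have "\<forall>\<^sub>F i in ae. \<Psi> v i = Some (the (\<Psi> v i))"
    by eventually_elim auto
  ultimately show ?case by auto
next
  case Zero
  then show ?case by (intro bexI[of _ "\<lambda>_. Some \<zero>"]) (auto simp: P_zero_one diag_def const_funs)
next
  case One
  then show ?case by (intro bexI[of _ "\<lambda>_. Some \<one>"]) (auto simp: P_zero_one diag_def const_funs)
next
  case (Plus s t)
  then obtain \<chi> \<xi> where \<chi>: "\<chi> \<in> funs" "rterm_val P (map_rterm (\<lambda>v. cl (\<Psi> v)) s) = cl \<chi>"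
      "\<forall>\<^sub>F i in ae. \<chi> i = Some (rterm_val K (map_rterm (\<lambda>v. the (\<Psi> v i)) s))"
    and \<xi>: "\<xi> \<in> funs" "rterm_val P (map_rterm (\<lambda>v. cl (\<Psi> v)) t) = cl \<xi>"
      "\<forall>\<^sub>F i in ae. \<xi> i = Some (rterm_val K (map_rterm (\<lambda>v. the (\<Psi> v i)) t))" by force
  have "\<forall>\<^sub>F i in ae. pointwise (\<oplus>) \<chi> \<xi> i = Some (rterm_val K (map_rterm (\<lambda>v. the (\<Psi> v i)) (Plus s t)))"
    using \<chi>(3) \<xi>(3) by eventually_elim (simp add: pointwise_def)
  then show ?case using P_ops(1) pointwise_funs(1) \<chi>(1,2) \<xi>(1,2) by auto
next
  case (Times s t)
  then obtain \<chi> \<xi> where \<chi>: "\<chi> \<in> funs" "rterm_val P (map_rterm (\<lambda>v. cl (\<Psi> v)) s) = cl \<chi>"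
      "\<forall>\<^sub>F i in ae. \<chi> i = Some (rterm_val K (map_rterm (\<lambda>v. the (\<Psi> v i)) s))"
    and \<xi>: "\<xi> \<in> funs" "rterm_val P (map_rterm (\<lambda>v. cl (\<Psi> v)) t) = cl \<xi>"
      "\<forall>\<^sub>F i in ae. \<xi> i = Some (rterm_val K (map_rterm (\<lambda>v. the (\<Psi> v i)) t))" by force
  have "\<forall>\<^sub>F i in ae. pointwise (\<otimes>) \<chi> \<xi> i = Some (rterm_val K (map_rterm (\<lambda>v. the (\<Psi> v i)) (Times s t)))"
    using \<chi>(3) \<xi>(3) by eventually_elim (simp add: pointwise_def)
  then show ?case using P_ops(2) pointwise_funs(2) \<chi>(1,2) \<xi>(1,2) by auto
qed

lemma satisfies_P:
  assumes "\<And>v. v \<in> vars es \<Longrightarrow> \<Psi> v \<in> funs" "\<forall>\<^sub>F i in ae. satisfies K (\<lambda>v. the (\<Psi> v i)) es"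
  shows "satisfies P (\<lambda>v. cl (\<Psi> v)) es"
  unfolding satisfies_def
proof (intro ballI, clarify)
  fix s t assume st: "(s, t) \<in> set es"
  then have "consts_of s \<subseteq> vars es" "consts_of t \<subseteq> vars es" unfolding vars_def by fastforce+
  then obtain \<chi> \<xi> where \<chi>: "\<chi> \<in> funs" "rterm_val P (map_rterm (\<lambda>v. cl (\<Psi> v)) s) = cl \<chi>"
      "\<forall>\<^sub>F i in ae. \<chi> i = Some (rterm_val K (map_rterm (\<lambda>v. the (\<Psi> v i)) s))"
    and \<xi>: "\<xi> \<in> funs" "rterm_val P (map_rterm (\<lambda>v. cl (\<Psi> v)) t) = cl \<xi>"
      "\<forall>\<^sub>F i in ae. \<xi> i = Some (rterm_val K (map_rterm (\<lambda>v. the (\<Psi> v i)) t))"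
    using rterm_val_P[of s \<Psi>] rterm_val_P[of t \<Psi>] assms(1) by blast
  from \<chi>(3) \<xi>(3) assms(2) have "\<forall>\<^sub>F i in ae. \<chi> i = \<xi> i"
    by eventually_elim (use st in \<open>auto simp: satisfies_def\<close>)
  then show "rterm_val P (map_rterm (\<lambda>v. cl (\<Psi> v)) s) = rterm_val P (map_rterm (\<lambda>v. cl (\<Psi> v)) t)"
    using cl_eq \<chi> \<xi> by metis
qed

text \<open>Solvability at infinitely many points of \<open>C\<close> suffices, because the set of points where the
  system is solvable is c.e. and \<open>C\<close> is cohesive.\<close>

theorem transfer:
  assumes \<phi>s: "set \<phi>s \<subseteq> funs"
    and Given: "\<And>j. Given j \<in> vars es \<Longrightarrow> j < length \<phi>s"
    and Par: "\<And>c. Par c \<in> vars es \<Longrightarrow> c \<in> carrier K"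
    and inf: "infinite {i \<in> C. \<exists>a q. range a \<subseteq> carrier K \<and> range q \<subseteq> Q \<and>
      satisfies K (case_var (\<lambda>j. the ((\<phi>s ! j) i)) id a q) es}" (is "infinite ?I")
  obtains a q where "range a \<subseteq> carrier P" "range q \<subseteq> F"
    "satisfies P (case_var (\<lambda>j. cl (\<phi>s ! j)) diag a q) es"
proof -
  let ?W = "solvable \<phi>s es"
  have \<phi>s': "partial_computable \<phi> \<and> ran \<phi> \<subseteq> carrier K" if "\<phi> \<in> set \<phi>s" for \<phi>
    using \<phi>s that funsE by blast
  obtain A B :: "nat \<Rightarrow> nat \<rightharpoonup> nat" where
    AB: "\<And>j. partial_computable (A j)" "\<And>j. partial_computable (B j)"
    and dom: "\<And>j. dom (A j) = ?W" "\<And>j. dom (B j) = ?W"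
    and ran: "\<And>j. ran (A j) \<subseteq> carrier K" "\<And>j. ran (B j) \<subseteq> Q"
    and sat: "\<And>i. i \<in> ?W \<Longrightarrow> satisfies K
       (case_var (\<lambda>j. the ((\<phi>s ! j) i)) id (\<lambda>j. the (A j i)) (\<lambda>j. the (B j i))) es"
    using solve[of \<phi>s es, OF \<phi>s' Given Par] by blast
  have "\<forall>\<^sub>F i in ae. \<forall>\<phi>\<in>set \<phi>s. i \<in> dom \<phi>"
    using \<phi>s funsE(3) by (intro eventually_ball_finite) auto
  then have "finite {i \<in> C. \<not> (\<forall>\<phi>\<in>set \<phi>s. i \<in> dom \<phi>)}"
    unfolding eventually_inf_principal eventually_cofinite by (simp add: conj_commute)
  \<comment> \<open>A point of \<open>?I\<close> can fail to lie in \<open>?W\<close> only because a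
    given function is undefined there, which happens at finitely many points of
    \<open>C\<close>.\<close>
  moreover have "?I \<subseteq> {i \<in> C. \<not> (\<forall>\<phi>\<in>set \<phi>s. i \<in> dom \<phi>)} \<union> (C - - ?W)"
    unfolding solvable_def by blast
  ultimately have "\<not> C \<subseteq>\<^sup>* - ?W"
    using inf unfolding almost_subset_def by (blast dest: finite_subset)
  moreover have "ce_set ?W" unfolding ce_set_def using AB(1) dom(1) by blast
  ultimately have CW: "C \<subseteq>\<^sup>* ?W" using cohesive unfolding cohesive_def by blast
  have A: "A j \<in> funs" and B: "B j \<in> cohesive_funs C Q" for j
    using AB dom ran CW unfolding cohesive_funs_def by auto
  let ?\<Psi> = "case_var (\<lambda>j. \<phi>s ! j) (\<lambda>c _. Some c) A B"
  have "satisfies P (\<lambda>v. cl (?\<Psi> v)) es"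
  proof (rule satisfies_P)
    show "?\<Psi> v \<in> funs" if "v \<in> vars es" for v
      using that A subfuns[OF B] Given Par \<phi>s by (cases v) (auto intro: const_funs)
    have "(\<lambda>v. the (?\<Psi> v i)) = case_var (\<lambda>j. the ((\<phi>s ! j) i)) id (\<lambda>j. the (A j i)) (\<lambda>j. the (B j i))" for i
      by (auto simp: fun_eq_iff split: var.splits)
    then show "\<forall>\<^sub>F i in ae. satisfies K (\<lambda>v. the (?\<Psi> v i)) es"
      using CW sat unfolding almost_subset_iff by (auto elim: eventually_mono)
  qed
  moreover have "(\<lambda>v. cl (?\<Psi> v)) = case_var (\<lambda>j. cl (\<phi>s ! j)) diag (\<lambda>j. cl (A j)) (\<lambda>j. cl (B j))"
    by (auto simp: fun_eq_iff diag_def split: var.splits)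
  ultimately show thesis
    using that[of "\<lambda>j. cl (A j)" "\<lambda>j. cl (B j)"] A B
    unfolding carrier_P cohesive_subpower_def by auto
qed

section \<open>Field axioms for the cohesive power\<close>

lemma pointwise_in_carrier:
  "\<phi> \<in> funs \<Longrightarrow> \<phi> i = Some a \<Longrightarrow> a \<in> carrier K"
  using funsE(2) by (auto simp: ran_def)

lemma infinite_C_ae:
  assumes "\<forall>\<^sub>F i in ae. p i"
  shows "infinite {i \<in> C. p i}"
proof
  assume "finite {i \<in> C. p i}"
  moreover have "finite {i \<in> C. \<not> p i}"
    using assms unfolding eventually_inf_principal eventually_cofinite by (simp add: conj_commute)
  ultimately have "finite ({i \<in> C. p i} \<union> {i \<in> C. \<not> p i})" by blast
  then have "finite C" by (rule rev_finite_subset) blast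
  then show False using infinite_C by blast
qed

lemma Q_zero: "\<zero> \<in> Q"
  using subringE(2)[OF subfieldE(1)[OF subfield_Q]] .

text \<open>The identities hold between the representing functions themselves, since
  \<open>pointwise\<close> is strict and both sides have the same domain. Only the existence of
  negatives calls for \<open>transfer\<close>.\<close>

lemma P_abelian_group: "abelian_group P"
proof (rule abelian_groupI)
  fix x y assume "x \<in> carrier P" "y \<in> carrier P"
  then obtain \<phi> \<psi> where \<phi>: "\<phi> \<in> funs" "x = cl \<phi>" and \<psi>: "\<psi> \<in> funs" "y = cl \<psi>"
    unfolding carrier_P by blast
  then show "x \<oplus>\<^bsub>P\<^esub> y \<in> carrier P" using P_ops(1) pointwise_funs(1) carrier_P by auto
  have "pointwise (\<oplus>) \<phi> \<psi> = pointwise (\<oplus>) \<psi> \<phi>"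
    using \<phi> \<psi> by (auto simp: pointwise_def fun_eq_iff split: option.splits intro: a_comm pointwise_in_carrier)
  then show "x \<oplus>\<^bsub>P\<^esub> y = y \<oplus>\<^bsub>P\<^esub> x" using P_ops(1) \<phi> \<psi> by simp
  fix z assume "z \<in> carrier P"
  then obtain \<chi> where \<chi>: "\<chi> \<in> funs" "z = cl \<chi>" unfolding carrier_P by blast
  have "pointwise (\<oplus>) (pointwise (\<oplus>) \<phi> \<psi>) \<chi> = pointwise (\<oplus>) \<phi> (pointwise (\<oplus>) \<psi> \<chi>)"
    using \<phi> \<psi> \<chi> by (auto simp: pointwise_def fun_eq_iff split: option.splits intro!: a_assoc intro: pointwise_in_carrier)
  then show "x \<oplus>\<^bsub>P\<^esub> y \<oplus>\<^bsub>P\<^esub> z = x \<oplus>\<^bsub>P\<^esub> (y \<oplus>\<^bsub>P\<^esub> z)"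
    using P_ops(1) pointwise_funs(1) \<phi> \<psi> \<chi> by simp
next
  show "\<zero>\<^bsub>P\<^esub> \<in> carrier P" by (simp add: P_zero_one diag_closed)
  fix x assume "x \<in> carrier P"
  then obtain \<phi> where \<phi>: "\<phi> \<in> funs" "x = cl \<phi>" unfolding carrier_P by blast
  have "pointwise (\<oplus>) (\<lambda>_. Some \<zero>) \<phi> = \<phi>"
    using \<phi> by (auto simp: pointwise_def fun_eq_iff split: option.splits intro!: l_zero intro: pointwise_in_carrier)
  then show "\<zero>\<^bsub>P\<^esub> \<oplus>\<^bsub>P\<^esub> x = x"
    using P_ops(1)[OF const_funs \<phi>(1), of \<zero>] \<phi> by (simp add: P_zero_one diag_def)
  let ?es = "[(Plus (Const (Unk 0)) (Const (Given 0)), Zero)]"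
  show "\<exists>y\<in>carrier P. y \<oplus>\<^bsub>P\<^esub> x = \<zero>\<^bsub>P\<^esub>"
  proof (rule transfer[of "[\<phi>]" ?es])
    have "\<exists>a q. range a \<subseteq> carrier K \<and> range q \<subseteq> Q \<and>
      satisfies K (case_var (\<lambda>j. the (([\<phi>] ! j) i)) id a q) ?es" if "i \<in> dom \<phi>" for i
      using that \<phi>(1) Q_zero
      by (intro exI[of _ "\<lambda>_. \<ominus> the (\<phi> i)"] exI[of _ "\<lambda>_. \<zero>"])
        (auto simp: satisfies_def l_neg dest: pointwise_in_carrier)
    then show "infinite {i \<in> C. \<exists>a q. range a \<subseteq> carrier K \<and> range q \<subseteq> Q \<and>
      satisfies K (case_var (\<lambda>j. the (([\<phi>] ! j) i)) id a q) ?es}"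
      by (intro infinite_C_ae eventually_mono[OF funsE(3)[OF \<phi>(1)]])
  qed (use \<phi> in \<open>auto simp: vars_def satisfies_def\<close>)
qed

lemma P_cring: "cring P"
proof (rule cringI[OF P_abelian_group], rule Group.comm_monoidI)
  fix x y z assume "x \<in> carrier P" "y \<in> carrier P" "z \<in> carrier P"
  then obtain \<phi> \<psi> \<chi> where \<phi>: "\<phi> \<in> funs" "x = cl \<phi>" and \<psi>: "\<psi> \<in> funs" "y = cl \<psi>"
    and \<chi>: "\<chi> \<in> funs" "z = cl \<chi>"
    unfolding carrier_P by blast
  have "pointwise (\<otimes>) (pointwise (\<otimes>) \<phi> \<psi>) \<chi> = pointwise (\<otimes>) \<phi> (pointwise (\<otimes>) \<psi> \<chi>)"
    using \<phi> \<psi> \<chi> by (auto simp: pointwise_def fun_eq_iff split: option.splits intro!: m_assoc intro: pointwise_in_carrier)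
  then show "x \<otimes>\<^bsub>P\<^esub> y \<otimes>\<^bsub>P\<^esub> z = x \<otimes>\<^bsub>P\<^esub> (y \<otimes>\<^bsub>P\<^esub> z)"
    using P_ops(2) pointwise_funs(2) \<phi> \<psi> \<chi> by simp
  have "pointwise (\<otimes>) (pointwise (\<oplus>) \<phi> \<psi>) \<chi> = pointwise (\<oplus>) (pointwise (\<otimes>) \<phi> \<chi>) (pointwise (\<otimes>) \<psi> \<chi>)"
    using \<phi> \<psi> \<chi> by (auto simp: pointwise_def fun_eq_iff split: option.splits intro!: l_distr intro: pointwise_in_carrier)
  then show "(x \<oplus>\<^bsub>P\<^esub> y) \<otimes>\<^bsub>P\<^esub> z = x \<otimes>\<^bsub>P\<^esub> z \<oplus>\<^bsub>P\<^esub> y \<otimes>\<^bsub>P\<^esub> z"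
    using P_ops pointwise_funs \<phi> \<psi> \<chi> by simp
next
  fix x y assume "x \<in> carrier P" "y \<in> carrier P"
  then obtain \<phi> \<psi> where \<phi>: "\<phi> \<in> funs" "x = cl \<phi>" and \<psi>: "\<psi> \<in> funs" "y = cl \<psi>"
    unfolding carrier_P by blast
  then show "x \<otimes>\<^bsub>P\<^esub> y \<in> carrier P" using P_ops(2) pointwise_funs(2) carrier_P by auto
  have "pointwise (\<otimes>) \<phi> \<psi> = pointwise (\<otimes>) \<psi> \<phi>"
    using \<phi> \<psi> by (auto simp: pointwise_def fun_eq_iff split: option.splits intro: m_comm pointwise_in_carrier)
  then show "x \<otimes>\<^bsub>P\<^esub> y = y \<otimes>\<^bsub>P\<^esub> x" using P_ops(2) \<phi> \<psi> by simp
next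
  show "\<one>\<^bsub>P\<^esub> \<in> carrier P" by (simp add: P_zero_one diag_closed)
  fix x assume "x \<in> carrier P"
  then obtain \<phi> where \<phi>: "\<phi> \<in> funs" "x = cl \<phi>" unfolding carrier_P by blast
  have "pointwise (\<otimes>) (\<lambda>_. Some \<one>) \<phi> = \<phi>"
    using \<phi> by (auto simp: pointwise_def fun_eq_iff split: option.splits intro!: l_one intro: pointwise_in_carrier)
  then show "\<one>\<^bsub>P\<^esub> \<otimes>\<^bsub>P\<^esub> x = x"
    using P_ops(2)[OF const_funs \<phi>(1), of \<one>] \<phi> by (simp add: P_zero_one diag_def)
qed

lemma P_field: "Ring.field P"
proof (rule cring.cring_fieldI2[OF P_cring])
  show "\<zero>\<^bsub>P\<^esub> \<noteq> \<one>\<^bsub>P\<^esub>"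
    using diag_inj zero_not_one unfolding P_zero_one inj_on_def by blast
  fix x assume "x \<in> carrier P" and x0: "x \<noteq> \<zero>\<^bsub>P\<^esub>"
  then obtain \<phi> where \<phi>: "\<phi> \<in> funs" "x = cl \<phi>" unfolding carrier_P by blast
  let ?es = "[(Times (Const (Given 0)) (Const (Unk 0)), One)]"
  show "\<exists>y\<in>carrier P. x \<otimes>\<^bsub>P\<^esub> y = \<one>\<^bsub>P\<^esub>"
  proof (rule transfer[of "[\<phi>]" ?es])
    have *: "\<exists>a q. range a \<subseteq> carrier K \<and> range q \<subseteq> Q \<and>
      satisfies K (case_var (\<lambda>j. the (([\<phi>] ! j) i)) id a q) ?es" if "\<phi> i = Some b" "b \<noteq> \<zero>" for i b
    proof -
      have "b \<in> Units K" using that \<phi> pointwise_in_carrier by (simp add: field_Units)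
      then show ?thesis
        using that Q_zero by (intro exI[of _ "\<lambda>_. inv b"] exI[of _ "\<lambda>_. \<zero>"]) (auto simp: satisfies_def)
    qed
    \<comment> \<open>Being different from the zero class says only that the value differs from zero
      infinitely often on \<open>C\<close>, which is what \<open>transfer\<close> asks for.\<close>
    have "\<not> (\<forall>\<^sub>F i in ae. \<phi> i = Some \<zero>)"
      using x0 cl_eq[OF \<phi>(1) const_funs, of \<zero>] \<phi>(2) by (auto simp: P_zero_one diag_def)
    then have "infinite {i \<in> C. \<phi> i \<noteq> Some \<zero>}"
      unfolding eventually_inf_principal eventually_cofinite by (simp add: conj_commute)
    moreover have "finite {i \<in> C. i \<notin> dom \<phi>}"
      using funsE(3)[OF \<phi>(1)] unfolding eventually_inf_principal eventually_cofinite by (simp add: conj_commute)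
    ultimately have "infinite ({i \<in> C. \<phi> i \<noteq> Some \<zero>} - {i \<in> C. i \<notin> dom \<phi>})" by simp
    then show "infinite {i \<in> C. \<exists>a q. range a \<subseteq> carrier K \<and> range q \<subseteq> Q \<and>
      satisfies K (case_var (\<lambda>j. the (([\<phi>] ! j) i)) id a q) ?es}"
      by (rule infinite_super[rotated]) (use * in blast)
  qed (use \<phi> in \<open>auto simp: vars_def satisfies_def\<close>)
qed

end

section \<open>Polynomials with as many roots as their degree\<close>

lemma count_le_1_if_card_eq_size:
  assumes "card (set_mset M) = size M"
  shows "count M x \<le> 1"
proof -
  have "mset_set (set_mset M) \<subseteq># M" by (rule mset_set_set_mset_msubset)
  moreover have "\<not> mset_set (set_mset M) \<subset># M" using assms by (auto dest: mset_subset_size)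
  ultimately have "M = mset_set (set_mset M)" by (simp add: subset_mset.le_less)
  then have "count M x = count (mset_set (set_mset M)) x" by simp
  then show ?thesis by (simp add: count_mset_set')
qed

definition (in ring) root_set :: "'a list \<Rightarrow> 'a set" where
  "root_set p = {a \<in> carrier R. eval p a = \<zero>}"

context field begin

lemma set_roots:
  assumes "p \<in> carrier (poly_ring R)" "p \<noteq> []"
  shows "set_mset (roots p) = root_set p"
  using roots_mem_iff_is_root[OF assms(1)] assms(2) unfolding is_root_def root_set_def by auto

lemma root_set_bound:
  assumes "p \<in> carrier (poly_ring R)" "p \<noteq> []"
  shows "finite (root_set p)" "card (root_set p) \<le> length p - 1"
proof -
  show "finite (root_set p)" unfolding set_roots[OF assms, symmetric] by simp
  have "card (set_mset (roots p)) \<le> size (roots p)"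
    using size_mset_mono[OF mset_set_set_mset_msubset[of "roots p"]] by simp
  then show "card (root_set p) \<le> length p - 1"
    using size_roots_le_degree[OF assms(1)] set_roots[OF assms] by simp
qed

lemma full_root_set:
  assumes p: "p \<in> carrier (poly_ring R)" "p \<noteq> []"
    and S: "S \<subseteq> root_set p" "length p - 1 \<le> card S"
  shows "root_set p = S"
proof -
  have "card (root_set p) \<le> card S" using root_set_bound(2)[OF p] S(2) by simp
  then show ?thesis using card_seteq[OF root_set_bound(1)[OF p] S(1)] by simp
qed

text \<open>The number of roots with multiplicity is at most the degree, so degree-many distinct
  roots force \<open>p\<close> to split with simple roots. The multiset of roots of a divisor is
  contained in that of \<open>p\<close>.\<close>

lemma full_roots_divisor:
  assumes p: "p \<in> carrier (poly_ring R)" "p \<noteq> []" "length p - 1 \<le> card (root_set p)"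
    and q: "q \<in> carrier (poly_ring R)" "q pdivides p"
  shows "splitted q" "alg_mult q x \<le> 1"
proof -
  have "card (set_mset (roots p)) \<le> size (roots p)"
    using size_mset_mono[OF mset_set_set_mset_msubset[of "roots p"]] by simp
  then have size: "size (roots p) = length p - 1" "card (set_mset (roots p)) = size (roots p)"
    using size_roots_le_degree[OF p(1)] p(3) unfolding set_roots[OF p(1,2), symmetric] by auto
  then show "splitted q"
    using pdivides_imp_splitted[OF q(1) p(1,2) _ q(2)] unfolding splitted_def by simp
  have "roots q \<subseteq># roots p" by (rule pdivides_imp_roots_incl[OF q(1) p(1,2) q(2)])
  then have "count (roots q) x \<le> count (roots p) x" by (rule mset_subset_eq_count)
  also have "\<dots> \<le> 1" by (rule count_le_1_if_card_eq_size[OF size(2)])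
  finally show "alg_mult q x \<le> 1" unfolding alg_mult_eq_count_roots[OF q(1)] .
qed

lemma full_roots_if_simple:
  assumes p: "p \<in> carrier (poly_ring R)" "p \<noteq> []" "splitted p" "\<And>x. alg_mult p x \<le> 1"
  shows "card (root_set p) = length p - 1"
proof -
  have "count (roots p) x \<le> Suc 0" for x using p(4)[of x] unfolding alg_mult_eq_count_roots[OF p(1)] by simp
  then have "\<forall>x\<in>#roots p. count (roots p) x = 1"
    by (auto simp: le_Suc_eq count_eq_zero_iff)
  then have "size (roots p) = card (set_mset (roots p))"
    unfolding size_multiset_overloaded_eq by simp
  then show ?thesis using p(3) set_roots[OF p(1,2)] unfolding splitted_def by simp
qed

end

text \<open>Polynomials are coefficient lists with nonzero head; injectivity keeps the head nonzero,
  so \<open>map h\<close> needs no normalisation. The lemma serves the embedding into an algebraic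
  closure, the map \<open>diag\<close>, and the automorphisms of \<open>P\<close>.\<close>

lemma inj_hom_poly:
  assumes R: "Ring.field R" and S: "Ring.field S" and h: "h \<in> ring_hom R S" "inj_on h (carrier R)"
  shows "p \<in> carrier (univ_poly R (carrier R)) \<Longrightarrow> map h p \<in> carrier (univ_poly S (carrier S))"
    and "p \<in> carrier (univ_poly R (carrier R)) \<Longrightarrow> q \<in> carrier (univ_poly R (carrier R)) \<Longrightarrow>
      map h (ring.poly_mult R p q) = ring.poly_mult S (map h p) (map h q)"
    and "p \<in> carrier (univ_poly R (carrier R)) \<Longrightarrow> q \<in> carrier (univ_poly R (carrier R)) \<Longrightarrow>
      q pdivides\<^bsub>R\<^esub> p \<Longrightarrow> map h q pdivides\<^bsub>S\<^esub> map h p"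
    and "p \<in> carrier (univ_poly R (carrier R)) \<Longrightarrow> x \<in> carrier R \<Longrightarrow>
      ring.eval S (map h p) (h x) = h (ring.eval R p x)"
    and "p \<in> carrier (univ_poly R (carrier R)) \<Longrightarrow> h ` ring.root_set R p \<subseteq> ring.root_set S (map h p)"
proof -
  interpret R: field R by fact
  interpret S: field S by fact
  interpret ring_hom_ring R S h
    by (rule ring_hom_ringI2) (use R.is_ring S.is_ring h in auto)
  have nz: "h a \<noteq> \<zero>\<^bsub>S\<^esub>" if "a \<in> carrier R" "a \<noteq> \<zero>\<^bsub>R\<^esub>" for a
    using that h(2) hom_zero R.zero_closed unfolding inj_on_def by metis
  have sub: "set p \<subseteq> carrier R" if "p \<in> carrier (univ_poly R (carrier R))" for p
    using that unfolding univ_poly_carrier[symmetric] polynomial_def by auto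
  show 1: "map h p \<in> carrier (univ_poly S (carrier S))" if "p \<in> carrier (univ_poly R (carrier R))" for p
    using that nz unfolding univ_poly_carrier[symmetric] polynomial_def by (auto simp: hd_map dest: hd_in_set)
  show 2: "map h (ring.poly_mult R p q) = ring.poly_mult S (map h p) (map h q)"
    if p: "p \<in> carrier (univ_poly R (carrier R))" and q: "q \<in> carrier (univ_poly R (carrier R))" for p q
  proof -
    have "R.poly_mult p q \<in> carrier (univ_poly R (carrier R))"
      using R.poly_mult_closed[OF R.carrier_is_subring] p q unfolding univ_poly_carrier[symmetric] by blast
    from 1[OF this] have "S.normalize (map h (R.poly_mult p q)) = map h (R.poly_mult p q)"
      using S.normalize_polynomial unfolding univ_poly_carrier[symmetric] by blast
    then show ?thesis using poly_mult_hom'[OF sub[OF p] sub[OF q]] by simp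
  qed
  show "map h q pdivides\<^bsub>S\<^esub> map h p"
    if p: "p \<in> carrier (univ_poly R (carrier R))" and q: "q \<in> carrier (univ_poly R (carrier R))"
      and dvd: "q pdivides\<^bsub>R\<^esub> p" for p q
  proof -
    from dvd obtain r where "r \<in> carrier (univ_poly R (carrier R))" "p = R.poly_mult q r"
      unfolding pdivides_def factor_def univ_poly_mult by blast
    then show ?thesis
      using 1 2[OF q] unfolding pdivides_def factor_def univ_poly_mult by auto
  qed
  show 4: "S.eval (map h p) (h x) = h (R.eval p x)"
    if "p \<in> carrier (univ_poly R (carrier R))" "x \<in> carrier R" for p x
    using eval_hom'[OF that(2) sub[OF that(1)]] by simp
  show "h ` R.root_set p \<subseteq> S.root_set (map h p)"
    if "p \<in> carrier (univ_poly R (carrier R))" for p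
    using 4[OF that] unfolding R.root_set_def S.root_set_def by auto
qed

text \<open>The polynomial \<open>p\<close> may be any multiple of the minimal polynomial of
  \<open>x\<close>, which inherits splitting and simple roots as a divisor of
  \<open>p\<close>.\<close>

lemma galois_extensionI:
  fixes L (structure)
  assumes L: "Ring.field L" and F: "subfield F L"
    and ex: "\<And>x. x \<in> carrier L \<Longrightarrow> \<exists>p\<in>carrier (univ_poly L F). p \<noteq> [] \<and> x \<in> ring.root_set L p
      \<and> length p - 1 \<le> card (ring.root_set L p)"
  shows "galois_extension L F"
proof -
  interpret field L by fact
  have closure: "Ring.field alg_closure"
    using alg_closureE(1) by (rule algebraic_closure.axioms(1))
  let ?h = "indexed_const :: 'a \<Rightarrow> ('a list \<times> nat) multiset \<Rightarrow> 'a"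
  note F_sub = subfieldE(1)[OF F]
  have alg: "algebraic F x" if "x \<in> carrier L" for x
    using ex[OF that] algebraicI[of _ F x] unfolding over_def root_set_def by blast
  have Irr: "Irr F x \<in> carrier (univ_poly L F)" "pirreducible F (Irr F x)" "eval (Irr F x) x = \<zero>" if "x \<in> carrier L" for x
    using IrrE[OF F that] alg[OF that] unfolding over_def by blast+
  have minimal: "Irr F x pdivides p" if "x \<in> carrier L" "p \<in> carrier (univ_poly L F)" "eval p x = \<zero>" for x p
    using Irr_minimal[OF F that(1) _ that(2,3)] alg[OF that(1)] unfolding over_def by blast
  have "normal_extension L F"
    unfolding normal_extension_def algebraic_extension_def
  proof (intro conjI ballI impI alg)
    fix q assume q: "q \<in> carrier (univ_poly L F)" and "pirreducible F q \<and> (\<exists>x\<in>carrier L. eval q x = \<zero>)"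
    then obtain x where irr: "pirreducible F q" and x: "x \<in> carrier L" "eval q x = \<zero>" by blast
    obtain p where p: "p \<in> carrier (univ_poly L F)" "p \<noteq> []" "x \<in> root_set p" "length p - 1 \<le> card (root_set p)"
      using ex[OF x(1)] by blast
    \<comment> \<open>Irreducible polynomials with a common root are associated, so \<open>q\<close>
      divides everything that the minimal polynomial of \<open>x\<close> divides, in particular
      \<open>p\<close>.\<close>
    have "Irr F x divides\<^bsub>univ_poly L F\<^esub> q"
      using minimal[OF x(1) q x(2)] pdivides_iff_shell[OF F Irr(1)[OF x(1)] q] by blast
    then have "Irr F x \<in> Units (univ_poly L F) \<or> Irr F x \<sim>\<^bsub>univ_poly L F\<^esub> q"
      by (rule divides_pirreducible_condition[OF irr Irr(1)[OF x(1)]])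
    moreover have "Irr F x \<notin> Units (univ_poly L F)"
      using Irr(2)[OF x(1)] unfolding ring_irreducible_def Divisibility.irreducible_def by blast
    ultimately have "q divides\<^bsub>univ_poly L F\<^esub> Irr F x"
      unfolding associated_def by blast
    moreover have "Irr F x divides\<^bsub>univ_poly L F\<^esub> p"
      using minimal[OF x(1) p(1)] p(3) pdivides_iff_shell[OF F Irr(1)[OF x(1)] p(1)]
      unfolding root_set_def by blast
    ultimately have "q divides\<^bsub>univ_poly L F\<^esub> p"
      using monoid.divides_trans[OF ring.is_monoid[OF univ_poly_is_ring[OF F_sub]]] q by blast
    then have "q pdivides p" using pdivides_iff_shell[OF F q p(1)] by blast
    then show "splitted q"
      using full_roots_divisor(1)[OF carrier_polynomial_shell[OF F_sub p(1)] p(2,4)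
          carrier_polynomial_shell[OF F_sub q]] by blast
  qed
  moreover have "separable_extension L F"
    unfolding separable_extension_def algebraic_extension_def
  proof (intro conjI ballI alg)
    fix x and y :: "('a list \<times> nat) multiset \<Rightarrow> 'a" assume x: "x \<in> carrier L"
    obtain p where p: "p \<in> carrier (univ_poly L F)" "p \<noteq> []" "x \<in> root_set p" "length p - 1 \<le> card (root_set p)"
      using ex[OF x(1)] by blast
    note p' = carrier_polynomial_shell[OF F_sub p(1)] and Irr' = carrier_polynomial_shell[OF F_sub Irr(1)[OF x]]
    note hom = inj_hom_poly[OF assms(1) closure alg_closureE(2) indexed_const_inj_on]
    have "Irr F x pdivides p" using minimal[OF x p(1)] p(3) unfolding root_set_def by blast
    then have dvd: "map ?h (Irr F x) pdivides\<^bsub>alg_closure\<^esub> map ?h p" by (rule hom(3)[OF p' Irr'])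
    \<comment> \<open>Distinct roots in \<open>L\<close> stay distinct in the algebraic closure, so
      \<open>p\<close> keeps as many roots as its degree there.\<close>
    have "card (root_set p) = card (?h ` root_set p)"
      using indexed_const_inj_on by (intro card_image[symmetric]) (auto simp: root_set_def inj_on_def)
    also have "\<dots> \<le> card (ring.root_set alg_closure (map ?h p))"
      by (rule card_mono[OF field.root_set_bound(1)[OF closure hom(1)[OF p']] hom(5)[OF p']]) (use p in simp)
    finally show "ring.alg_mult alg_closure (map ?h (Irr F x)) y \<le> 1"
      using p by (intro field.full_roots_divisor(2)[OF closure hom(1)[OF p'] _ _ hom(1)[OF Irr'] dvd]) auto
  qed
  ultimately show ?thesis unfolding galois_extension_def using L F by blast
qed

text \<open>Normality makes the minimal polynomial split. Separability speaks about the algebraic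
  closure, so a hypothetical double root \<open>y\<close> in \<open>L\<close> is excluded by
  transporting the divisor \<open>(X - y)^2\<close> to the closure.\<close>

lemma galois_extension_roots:
  fixes L (structure)
  assumes gal: "galois_extension L F" and x: "x \<in> carrier L"
  shows "ring.Irr L F x \<in> carrier (univ_poly L F)" "ring.Irr L F x \<noteq> []"
    "hd (ring.Irr L F x) = \<one>\<^bsub>L\<^esub>" "x \<in> ring.root_set L (ring.Irr L F x)"
    "card (ring.root_set L (ring.Irr L F x)) = length (ring.Irr L F x) - 1"
proof -
  have L: "Ring.field L" and F: "subfield F L" and alg: "ring.algebraic L F x"
    using assms unfolding galois_extension_def normal_extension_def algebraic_extension_def by auto
  interpret field L by fact
  have closure: "Ring.field alg_closure"
    using alg_closureE(1) by (rule algebraic_closure.axioms(1))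
  let ?h = "indexed_const :: 'a \<Rightarrow> ('a list \<times> nat) multiset \<Rightarrow> 'a"
  let ?p = "Irr F x"
  note F_sub = subfieldE(1)[OF F]
  have Irr: "?p \<in> carrier (univ_poly L F)" "pirreducible F ?p" "eval ?p x = \<zero>" "hd ?p = \<one>"
    using IrrE[OF F x] alg unfolding over_def by blast+
  show "?p \<in> carrier (univ_poly L F)" "hd ?p = \<one>" by fact+
  show nz: "?p \<noteq> []" using pirreducibleE(1)[OF F_sub Irr(1,2)] .
  show "x \<in> root_set ?p" using x Irr unfolding root_set_def by blast
  have split: "splitted ?p"
    using gal Irr x unfolding galois_extension_def normal_extension_def by blast
  have p: "?p \<in> carrier (univ_poly L (carrier L))" using carrier_polynomial_shell[OF F_sub Irr(1)] .
  note hom = inj_hom_poly[OF L closure alg_closureE(2) indexed_const_inj_on]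
  interpret h: ring_hom_ring L alg_closure ?h
    by (rule ring_hom_ringI2) (use ring_axioms field.is_ring[OF closure] alg_closureE(2) in auto)
  have "alg_mult ?p y \<le> 1" for y
  proof (rule ccontr)
    assume "\<not> alg_mult ?p y \<le> 1"
    then have 2: "2 \<le> alg_mult ?p y" and y: "y \<in> carrier L" unfolding alg_mult_def by (auto split: if_splits)
    have lin: "[\<one>, \<ominus> y] \<in> carrier (univ_poly L (carrier L))"
      using y unfolding univ_poly_carrier[symmetric] polynomial_def by auto
    interpret UP: domain "univ_poly L (carrier L)" by (rule univ_poly_is_domain[OF carrier_is_subring])
    interpret UC: domain "univ_poly alg_closure (carrier alg_closure)"
      by (rule domain.univ_poly_is_domain[OF field.axioms(1)[OF closure] ring.carrier_is_subring[OF field.is_ring[OF closure]]])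
    \<comment> \<open>The square is kept as an explicit product because the embedding is known to
      respect products, while \<open>alg_mult\<close> is phrased with powers.\<close>
    let ?sq = "ring.poly_mult L [\<one>, \<ominus> y] [\<one>, \<ominus> y]"
    have "?sq = [\<one>, \<ominus> y] [^]\<^bsub>univ_poly L (carrier L)\<^esub> (2::nat)"
      using UP.nat_pow_Suc[of "[\<one>, \<ominus> y]" 1] UP.nat_pow_eone[OF lin] by (simp add: numeral_2_eq_2 univ_poly_mult)
    then have dvd: "?sq pdivides ?p" using le_alg_mult_imp_pdivides[OF y p 2] by simp
    have sq: "?sq \<in> carrier (univ_poly L (carrier L))" using UP.m_closed[OF lin lin] by (simp add: univ_poly_mult)
    let ?lin = "[\<one>\<^bsub>alg_closure\<^esub>, \<ominus>\<^bsub>alg_closure\<^esub> ?h y]"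
    have map_lin: "map ?h [\<one>, \<ominus> y] = ?lin" using y by simp
    have "map ?h ?sq = ring.poly_mult alg_closure ?lin ?lin"
      using hom(2)[OF lin lin] unfolding map_lin .
    also have "\<dots> = ?lin [^]\<^bsub>univ_poly alg_closure (carrier alg_closure)\<^esub> (2::nat)"
      using UC.nat_pow_Suc[of ?lin 1] UC.nat_pow_eone[OF hom(1)[OF lin, unfolded map_lin]]
      by (simp add: numeral_2_eq_2 univ_poly_mult)
    finally have "?lin [^]\<^bsub>univ_poly alg_closure (carrier alg_closure)\<^esub> (2::nat) pdivides\<^bsub>alg_closure\<^esub> map ?h ?p"
      using hom(3)[OF p sq dvd] by simp
    then have "2 \<le> ring.alg_mult alg_closure (map ?h ?p) (?h y)"
      using domain.alg_multE(2)[OF field.axioms(1)[OF closure] _ hom(1)[OF p]] nz y by auto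
    moreover have "ring.alg_mult alg_closure (map ?h ?p) (?h y) \<le> 1"
      using gal x y h.hom_closed unfolding galois_extension_def separable_extension_def by blast
    ultimately show False by simp
  qed
  then show "card (root_set ?p) = length ?p - 1"
    using full_roots_if_simple[OF p nz split] by blast
qed

text \<open>The powers of \<open>x\<close> below the degree of its minimal polynomial are
  independent over \<open>F\<close>, and the dimension bounds their number. This keeps the degrees
  along \<open>C\<close> in a finite range.\<close>

lemma Irr_degree_le:
  assumes "Ring.field L" "subfield F L" "x \<in> carrier L" "ring.algebraic L F x" "ring.dimension L n F (carrier L)"
  shows "length (ring.Irr L F x) - 1 \<le> n"
proof -
  interpret field L by fact
  have "length (exp_base x (length (Irr F x) - 1)) \<le> n"
    by (rule independent_length_le_dimension[OF assms(2,5) exp_base_independent[OF assms(2,3)] exp_base_closed[OF assms(3)]])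
      (use assms(4) in \<open>simp add: over_def\<close>)
  then show ?thesis by (simp add: exp_base_def)
qed

section \<open>The cohesive power is a Galois extension\<close>

primrec pow_term :: "'a rterm \<Rightarrow> nat \<Rightarrow> 'a rterm" where
  "pow_term s 0 = One"
| "pow_term s (Suc n) = Times (pow_term s n) s"

text \<open>Coefficients are listed from the leading one down, as \<open>eval\<close>
  expects.\<close>

primrec poly_term :: "'a list \<Rightarrow> 'a \<Rightarrow> 'a rterm" where
  "poly_term [] x = Zero"
| "poly_term (c # cs) x = Plus (Times (Const c) (pow_term (Const x) (length cs))) (poly_term cs x)"

lemma consts_of_poly_term: "consts_of (poly_term cs x) \<subseteq> insert x (set cs)"
proof -
  have "consts_of (pow_term (Const x) n) \<subseteq> {x}" for n by (induction n) auto
  then show ?thesis by (induction cs) auto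
qed

primrec comb_term :: "nat \<Rightarrow> nat list \<Rightarrow> var rterm" where
  "comb_term k [] = Zero"
| "comb_term k (u # us) = Plus (Times (Const (Rat k)) (Const (Par u))) (comb_term (Suc k) us)"

lemma consts_of_comb_term: "consts_of (comb_term k us) \<subseteq> range Rat \<union> Par ` set us"
  by (induction us arbitrary: k) auto

context ring begin

lemma rterm_val_poly_term:
  "rterm_val R (map_rterm v (poly_term cs x)) = eval (map v cs) (v x)"
proof -
  have "rterm_val R (map_rterm v (pow_term (Const x) n)) = v x [^] n" for n
    by (induction n) auto
  then show ?thesis by (induction cs) auto
qed

lemma rterm_val_comb_term:
  "rterm_val R (map_rterm v (comb_term k us)) =
     combine (map (\<lambda>j. v (Rat j)) [k..<k + length us]) (map (\<lambda>u. v (Par u)) us)"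
proof (induction us arbitrary: k)
  case (Cons u us)
  have "[k..<k + length (u # us)] = k # [Suc k..<Suc k + length us]"
    by (subst upt_conv_Cons) simp_all
  then show ?case using Cons by simp
qed simp

end

lemma (in ring_hom_ring) hom_combine:
  "set ks \<subseteq> carrier R \<Longrightarrow> set us \<subseteq> carrier R \<Longrightarrow>
   h (R.combine ks us) = S.combine (map h ks) (map h us)"
  by (induction ks us rule: R.combine.induct) auto

context cohesive_number_field begin

section \<open>The rational classes form a subfield\<close>

sublocale P: field P by (rule P_field)

lemma transfer_ae:
  assumes "set \<phi>s \<subseteq> funs"
    and "\<And>j. Given j \<in> vars es \<Longrightarrow> j < length \<phi>s"
    and "\<And>c. Par c \<in> vars es \<Longrightarrow> c \<in> carrier K"
    and "\<And>i. \<forall>\<phi>\<in>set \<phi>s. i \<in> dom \<phi> \<Longrightarrow> \<exists>a q. range a \<subseteq> carrier K \<and> range q \<subseteq> Q \<and>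
      satisfies K (case_var (\<lambda>j. the ((\<phi>s ! j) i)) id a q) es"
  obtains a q where "range a \<subseteq> carrier P" "range q \<subseteq> F"
    "satisfies P (case_var (\<lambda>j. cl (\<phi>s ! j)) diag a q) es"
proof (rule transfer[OF assms(1-3)])
  have "\<forall>\<^sub>F i in ae. \<forall>\<phi>\<in>set \<phi>s. i \<in> dom \<phi>"
    using assms(1) funsE(3) by (intro eventually_ball_finite) auto
  then show "infinite {i \<in> C. \<exists>a q. range a \<subseteq> carrier K \<and> range q \<subseteq> Q \<and>
      satisfies K (case_var (\<lambda>j. the ((\<phi>s ! j) i)) id a q) es}"
    using assms(4) by (intro infinite_C_ae) (auto elim: eventually_mono)
qed (use that in blast)+

lemma value_in_Q: "\<phi> \<in> cohesive_funs C Q \<Longrightarrow> i \<in> dom \<phi> \<Longrightarrow> the (\<phi> i) \<in> Q"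
  using funsE(2)[of \<phi> Q] the_in_ran[of i \<phi>] by blast

lemma value_in_carrier: "\<phi> \<in> funs \<Longrightarrow> i \<in> dom \<phi> \<Longrightarrow> the (\<phi> i) \<in> carrier K"
  using funsE(2)[of \<phi> "carrier K"] the_in_ran[of i \<phi>] by blast

lemma subfield_F: "subfield F P"
proof -
  note Q_sub = subringE[OF subfieldE(1)[OF subfield_Q]]
  have rep: "\<exists>\<phi>\<in>cohesive_funs C Q. x = cl \<phi>" if "x \<in> F" for x
    using that unfolding cohesive_subpower_def by blast
  have closed: "q 0 \<in> F" if "range q \<subseteq> F" for q :: "nat \<Rightarrow> (nat \<rightharpoonup> nat) set"
    using that by blast
  show ?thesis
  proof (rule P.subfieldI'[OF P.subringI[OF F_carrier]])
    show "\<one>\<^bsub>P\<^esub> \<in> F" unfolding P_zero_one using diag_F Q_sub(3) by blast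
  next
    fix x assume "x \<in> F"
    then obtain \<phi> where \<phi>: "\<phi> \<in> cohesive_funs C Q" "x = cl \<phi>" using rep by blast
    let ?es = "[(Plus (Const (Rat 0)) (Const (Given 0)), Zero)]"
    obtain a q where *: "range q \<subseteq> F" "satisfies P (case_var (\<lambda>j. cl ([\<phi>] ! j)) diag a q) ?es"
    proof (rule transfer_ae[of "[\<phi>]" ?es])
      fix i assume "\<forall>\<phi>\<in>set [\<phi>]. i \<in> dom \<phi>"
      then have v: "the (\<phi> i) \<in> Q" using value_in_Q \<phi> by simp
      then have "the (\<phi> i) \<in> carrier K" using Q_carrier by blast
      then show "\<exists>a q. range a \<subseteq> carrier K \<and> range q \<subseteq> Q \<and>
          satisfies K (case_var (\<lambda>j. the (([\<phi>] ! j) i)) id a q) ?es"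
        using v Q_sub(5) by (intro exI[of _ "\<lambda>_. \<zero>"] exI[of _ "\<lambda>_. \<ominus> the (\<phi> i)"]) (auto simp: satisfies_def l_neg)
    qed (use subfuns \<phi> in \<open>auto simp: vars_def\<close>)
    then have "q 0 \<oplus>\<^bsub>P\<^esub> x = \<zero>\<^bsub>P\<^esub>" using \<phi> by (simp add: satisfies_def)
    then have "\<ominus>\<^bsub>P\<^esub> x = q 0"
      using P.minus_equality F_carrier \<open>x \<in> F\<close> closed[OF *(1)] by blast
    then show "\<ominus>\<^bsub>P\<^esub> x \<in> F" using closed[OF *(1)] by simp
  next
    fix x y assume "x \<in> F" "y \<in> F"
    then obtain \<phi> \<psi> where \<phi>: "\<phi> \<in> cohesive_funs C Q" "x = cl \<phi>" and \<psi>: "\<psi> \<in> cohesive_funs C Q" "y = cl \<psi>"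
      using rep by blast
    have v: "the (\<phi> i) \<in> Q" "the (\<psi> i) \<in> Q" if "\<forall>\<phi>\<in>set [\<phi>, \<psi>]. i \<in> dom \<phi>" for i
      using value_in_Q \<phi> \<psi> that by auto
    let ?es = "[(Const (Rat 0), Times (Const (Given 0)) (Const (Given 1)))]"
    obtain a q where *: "range q \<subseteq> F" "satisfies P (case_var (\<lambda>j. cl ([\<phi>, \<psi>] ! j)) diag a q) ?es"
    proof (rule transfer_ae[of "[\<phi>, \<psi>]" ?es])
      fix i assume "\<forall>\<phi>\<in>set [\<phi>, \<psi>]. i \<in> dom \<phi>"
      then show "\<exists>a q. range a \<subseteq> carrier K \<and> range q \<subseteq> Q \<and>
          satisfies K (case_var (\<lambda>j. the (([\<phi>, \<psi>] ! j) i)) id a q) ?es"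
        using v Q_sub(6) by (intro exI[of _ "\<lambda>_. \<zero>"] exI[of _ "\<lambda>_. the (\<phi> i) \<otimes> the (\<psi> i)"]) (auto simp: satisfies_def)
    qed (use subfuns \<phi> \<psi> in \<open>auto simp: vars_def\<close>)
    then have "q 0 = x \<otimes>\<^bsub>P\<^esub> y" using \<phi> \<psi> by (simp add: satisfies_def)
    then show "x \<otimes>\<^bsub>P\<^esub> y \<in> F" using closed[OF *(1)] by simp
    let ?es = "[(Const (Rat 0), Plus (Const (Given 0)) (Const (Given 1)))]"
    obtain a q where *: "range q \<subseteq> F" "satisfies P (case_var (\<lambda>j. cl ([\<phi>, \<psi>] ! j)) diag a q) ?es"
    proof (rule transfer_ae[of "[\<phi>, \<psi>]" ?es])
      fix i assume "\<forall>\<phi>\<in>set [\<phi>, \<psi>]. i \<in> dom \<phi>"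
      then show "\<exists>a q. range a \<subseteq> carrier K \<and> range q \<subseteq> Q \<and>
          satisfies K (case_var (\<lambda>j. the (([\<phi>, \<psi>] ! j) i)) id a q) ?es"
        using v Q_sub(7) by (intro exI[of _ "\<lambda>_. \<zero>"] exI[of _ "\<lambda>_. the (\<phi> i) \<oplus> the (\<psi> i)"]) (auto simp: satisfies_def)
    qed (use subfuns \<phi> \<psi> in \<open>auto simp: vars_def\<close>)
    then have "q 0 = x \<oplus>\<^bsub>P\<^esub> y" using \<phi> \<psi> by (simp add: satisfies_def)
    then show "x \<oplus>\<^bsub>P\<^esub> y \<in> F" using closed[OF *(1)] by simp
  next
    fix x assume x: "x \<in> F - {\<zero>\<^bsub>P\<^esub>}"
    then obtain \<phi> where \<phi>: "\<phi> \<in> cohesive_funs C Q" "x = cl \<phi>" using rep by blast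
    \<comment> \<open>The equation \<open>x * (x * z) = x\<close> is solvable in \<open>Q\<close>
      even when \<open>x\<close> is zero, so it can be posed at every index where \<phi> is defined.
      Cancelling the nonzero class \<open>x\<close> then gives the inverse.\<close>
    let ?es = "[(Times (Const (Given 0)) (Times (Const (Given 0)) (Const (Rat 0))), Const (Given 0))]"
    obtain a q where *: "range q \<subseteq> F" "satisfies P (case_var (\<lambda>j. cl ([\<phi>] ! j)) diag a q) ?es"
    proof (rule transfer_ae[of "[\<phi>]" ?es])
      fix i assume "\<forall>\<phi>\<in>set [\<phi>]. i \<in> dom \<phi>"
      then have v: "the (\<phi> i) \<in> Q" using value_in_Q \<phi> by simp
      then have c: "the (\<phi> i) \<in> carrier K" using Q_carrier by blast
      show "\<exists>a q. range a \<subseteq> carrier K \<and> range q \<subseteq> Q \<and>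
          satisfies K (case_var (\<lambda>j. the (([\<phi>] ! j) i)) id a q) ?es"
      proof (cases "the (\<phi> i) = \<zero>")
        case True
        then show ?thesis using Q_zero Q_carrier
          by (intro exI[of _ "\<lambda>_. \<zero>"] exI[of _ "\<lambda>_. \<zero>"]) (auto simp: satisfies_def)
      next
        case False
        then have "inv the (\<phi> i) \<in> Q" and "the (\<phi> i) \<in> Units K"
          using subfield_m_inv(1)[OF subfield_Q, of "the (\<phi> i)"] v c by (auto simp: field_Units)
        then show ?thesis using c
          by (intro exI[of _ "\<lambda>_. \<zero>"] exI[of _ "\<lambda>_. inv the (\<phi> i)"]) (auto simp: satisfies_def)
      qed
    qed (use subfuns \<phi> in \<open>auto simp: vars_def\<close>)
    then have eq: "x \<otimes>\<^bsub>P\<^esub> (x \<otimes>\<^bsub>P\<^esub> q 0) = x" using \<phi> by (simp add: satisfies_def)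
    have xP: "x \<in> carrier P" and qP: "q 0 \<in> carrier P" and x0: "x \<noteq> \<zero>\<^bsub>P\<^esub>"
      using x F_carrier closed[OF *(1)] by auto
    have "x \<otimes>\<^bsub>P\<^esub> (x \<otimes>\<^bsub>P\<^esub> q 0) = x \<otimes>\<^bsub>P\<^esub> \<one>\<^bsub>P\<^esub>" unfolding eq using xP by simp
    then have "x \<otimes>\<^bsub>P\<^esub> q 0 = \<one>\<^bsub>P\<^esub>"
      using P.m_lcancel[OF x0 xP P.m_closed[OF xP qP] P.one_closed] by blast
    then have "inv\<^bsub>P\<^esub> x = q 0" using P.comm_inv_char[OF xP qP] by simp
    then show "inv\<^bsub>P\<^esub> x \<in> F" using closed[OF *(1)] by simp
  qed
qed

end

locale cohesive_galois_number_field = cohesive_number_field +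
  assumes galois: "galois_extension K Q"
begin

text \<open>The system of degree \<open>d\<close> asks for a monic rational polynomial of degree \<open>d\<close> vanishing at the
  given element and at \<open>d\<close> unknowns; the remaining unknowns are inverses of differences, which
  makes these \<open>d\<close> roots distinct.\<close>

definition root_system :: "nat \<Rightarrow> (var rterm \<times> var rterm) list" where
  "root_system d =
     (Const (Rat 0), One) # (poly_term (map Rat [0..<Suc d]) (Given 0), Zero) #
     map (\<lambda>j. (poly_term (map Rat [0..<Suc d]) (Unk j), Zero)) [0..<d] @
     concat (map (\<lambda>j. map (\<lambda>k. (Times (Const (Unk j)) (Const (Unk (d + prod_encode (j, k)))),
       Plus (Times (Const (Unk k)) (Const (Unk (d + prod_encode (j, k))))) One)) [0..<j]) [0..<d])"

lemma vars_root_system: "vars (root_system d) \<subseteq> insert (Given 0) (range Unk \<union> range Rat)"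
  unfolding root_system_def vars_def
  using consts_of_poly_term[of "map Rat [0..<Suc d]"] by (auto, fastforce+)

text \<open>The last clause states \<open>(a j - a k) * c = 1\<close>, with the subtracted product
  moved to the right because terms have no minus.\<close>

lemma satisfies_root_system:
  assumes "ring R"
  shows "satisfies R (case_var x c a q) (root_system d) \<longleftrightarrow>
    q 0 = \<one>\<^bsub>R\<^esub> \<and> ring.eval R (map q [0..<Suc d]) (x 0) = \<zero>\<^bsub>R\<^esub> \<and>
    (\<forall>j<d. ring.eval R (map q [0..<Suc d]) (a j) = \<zero>\<^bsub>R\<^esub>) \<and>
    (\<forall>j<d. \<forall>k<j. a j \<otimes>\<^bsub>R\<^esub> a (d + prod_encode (j, k)) =
       a k \<otimes>\<^bsub>R\<^esub> a (d + prod_encode (j, k)) \<oplus>\<^bsub>R\<^esub> \<one>\<^bsub>R\<^esub>)"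
proof -
  have "map (case_var x c a q) (map Rat [0..<Suc d]) = map q [0..<Suc d]" by simp
  then have "rterm_val R (map_rterm (case_var x c a q) (poly_term (map Rat [0..<Suc d]) v)) =
      ring.eval R (map q [0..<Suc d]) (case_var x c a q v)" for v
    using ring.rterm_val_poly_term[OF assms] by metis
  then show ?thesis
    unfolding satisfies_def root_system_def
    by (simp del: upt_Suc add: ball_Un) (auto simp del: upt_Suc)
qed

text \<open>The minimal polynomial of the value \<open>x 0\<close> is the witness: it is monic and,
  by the Galois hypothesis, has exactly \<open>d\<close> distinct roots in \<open>K\<close>.\<close>

lemma root_system_solvable:
  assumes y: "x 0 \<in> carrier K" and d: "d = length (ring.Irr K Q (x 0)) - 1"
  shows "\<exists>a q. range a \<subseteq> carrier K \<and> range q \<subseteq> Q \<and> satisfies K (case_var x id a q) (root_system d)"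
proof -
  let ?p = "Irr Q (x 0)"
  note p = galois_extension_roots[OF galois y]
  have len: "length ?p = Suc d" using p(2) d by (cases ?p) auto
  have set_p: "set ?p \<subseteq> Q" using p(1) unfolding univ_poly_carrier[symmetric] polynomial_def by auto
  have "finite (root_set ?p)"
    using root_set_bound(1)[OF carrier_polynomial_shell[OF subfieldE(1)[OF subfield_Q] p(1)] p(2)] .
  then obtain \<rho> where \<rho>: "set \<rho> = root_set ?p" "distinct \<rho>" using finite_distinct_list by blast
  have len_\<rho>: "length \<rho> = d" using distinct_card[OF \<rho>(2)] \<rho>(1) p(5) d by simp
  have \<rho>_root: "\<rho> ! j \<in> carrier K" "eval ?p (\<rho> ! j) = \<zero>" if "j < d" for j
    using nth_mem[of j \<rho>] that len_\<rho> \<rho>(1) unfolding root_set_def by auto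
  define diff where "diff j k = \<rho> ! j \<ominus> \<rho> ! k" for j k
  have diff: "diff j k \<in> Units K" if "j < d" "k < d" "j \<noteq> k" for j k
  proof -
    have "\<rho> ! j \<noteq> \<rho> ! k" using nth_eq_iff_index_eq[OF \<rho>(2)] that len_\<rho> by simp
    then show ?thesis
      using \<rho>_root that unfolding diff_def field_Units by (auto simp: r_right_minus_eq)
  qed
  \<comment> \<open>The first \<open>d\<close> unknowns are the roots; from index \<open>d\<close>
    on they are numbered by pairs and hold the inverses of differences. Pairs that do not satisfy
    \<open>k < j < d\<close> receive zero.\<close>
  define a where "a l = (if l < d then \<rho> ! l else case prod_decode (l - d) of (j, k) \<Rightarrow>
      if j < d \<and> k < j then inv (diff j k) else \<zero>)" for l
  define q where "q j = (if j < Suc d then ?p ! j else \<zero>)" for j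
  have map_q: "map q [0..<Suc d] = ?p"
    by (intro nth_equalityI) (auto simp del: upt_Suc simp: q_def len)
  have a_carrier: "a l \<in> carrier K" for l
    unfolding a_def using \<rho>_root diff by (auto split: prod.split)
  have "range q \<subseteq> Q" unfolding q_def using set_p Q_zero len by (auto simp: subset_iff)
  moreover have "satisfies K (case_var x id a q) (root_system d)"
    unfolding satisfies_root_system[OF ring_axioms] map_q
  proof (intro conjI allI impI)
    show "q 0 = \<one>" unfolding q_def using p(2,3) by (simp add: hd_conv_nth)
    show "eval ?p (x 0) = \<zero>" using p(4) unfolding root_set_def by blast
    fix j assume j: "j < d"
    then show "eval ?p (a j) = \<zero>" using \<rho>_root unfolding a_def by simp
    fix k assume k: "k < j"
    have a: "a (d + prod_encode (j, k)) = inv (diff j k)" "a j = \<rho> ! j" "a k = \<rho> ! k"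
      unfolding a_def using j k by simp_all
    have u: "diff j k \<in> Units K" using diff j k by simp
    have "\<rho> ! j = \<rho> ! k \<oplus> diff j k"
      unfolding diff_def using \<rho>_root j k by (simp add: a_minus_def a_lcomm r_neg)
    then have "\<rho> ! j \<otimes> inv (diff j k) = (\<rho> ! k \<oplus> diff j k) \<otimes> inv (diff j k)" by simp
    also have "\<dots> = \<rho> ! k \<otimes> inv (diff j k) \<oplus> \<one>"
      using u \<rho>_root[of k] j k by (simp add: l_distr Units_closed)
    finally have "\<rho> ! j \<otimes> inv (diff j k) = \<rho> ! k \<otimes> inv (diff j k) \<oplus> \<one>" .
    then show "a j \<otimes> a (d + prod_encode (j, k)) = a k \<otimes> a (d + prod_encode (j, k)) \<oplus> \<one>"
      unfolding a .
  qed
  ultimately show ?thesis using a_carrier by blast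
qed

lemma algebraic_Q: "x \<in> carrier K \<Longrightarrow> algebraic Q x"
  using galois unfolding galois_extension_def normal_extension_def algebraic_extension_def by blast

lemma finite_dimension_Q: "\<exists>n. dimension n Q (carrier K)"
  using number_field unfolding number_field_def Q_def finite_dimension_def by blast

text \<open>The degree of the minimal polynomial takes only finitely many values, hence one of them
  occurs infinitely often on \<open>C\<close>.\<close>

lemma root_in_P:
  assumes "U \<in> carrier P"
  shows "\<exists>p\<in>carrier (univ_poly P F). p \<noteq> [] \<and> U \<in> P.root_set p \<and> length p - 1 \<le> card (P.root_set p)"
proof -
  obtain \<phi> where \<phi>: "\<phi> \<in> funs" "U = cl \<phi>" using assms unfolding carrier_P by blast
  obtain n where n: "dimension n Q (carrier K)" using finite_dimension_Q by blast
  let ?S = "\<lambda>d. {i \<in> C. \<exists>a q. range a \<subseteq> carrier K \<and> range q \<subseteq> Q \<and>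
      satisfies K (case_var (\<lambda>j. the (([\<phi>] ! j) i)) id a q) (root_system d)}"
  have "{i \<in> C. i \<in> dom \<phi>} \<subseteq> (\<Union>d\<le>n. ?S d)"
  proof
    fix i assume i: "i \<in> {i \<in> C. i \<in> dom \<phi>}"
    then have y: "the (([\<phi>] ! 0) i) \<in> carrier K" using value_in_carrier[OF \<phi>(1)] by simp
    let ?d = "length (Irr Q (the (([\<phi>] ! 0) i))) - 1"
    have "?d \<le> n" by (rule Irr_degree_le[OF field_axioms subfield_Q y algebraic_Q[OF y] n])
    moreover have "i \<in> ?S ?d"
      using root_system_solvable[of "\<lambda>j. the (([\<phi>] ! j) i)", OF y refl] i by blast
    ultimately show "i \<in> (\<Union>d\<le>n. ?S d)" by blast
  qed
  then have "infinite (\<Union>d\<le>n. ?S d)"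
    using infinite_C_ae[OF funsE(3)[OF \<phi>(1)]] infinite_super by blast
  then obtain d where d: "infinite (?S d)" by auto
  obtain a q where a: "range a \<subseteq> carrier P" and q: "range q \<subseteq> F"
    and sat: "satisfies P (case_var (\<lambda>j. cl ([\<phi>] ! j)) diag a q) (root_system d)"
    by (rule transfer[of "[\<phi>]" "root_system d", OF _ _ _ d]) (use vars_root_system \<phi> in auto)
  let ?p = "map q [0..<Suc d]"
  from sat have q0: "q 0 = \<one>\<^bsub>P\<^esub>" and U: "P.eval ?p U = \<zero>\<^bsub>P\<^esub>"
    and roots: "\<And>j. j < d \<Longrightarrow> P.eval ?p (a j) = \<zero>\<^bsub>P\<^esub>"
    and dist: "\<And>j k. j < d \<Longrightarrow> k < j \<Longrightarrow> a j \<otimes>\<^bsub>P\<^esub> a (d + prod_encode (j, k)) =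
       a k \<otimes>\<^bsub>P\<^esub> a (d + prod_encode (j, k)) \<oplus>\<^bsub>P\<^esub> \<one>\<^bsub>P\<^esub>"
    unfolding satisfies_root_system[OF P.ring_axioms] \<phi>(2) by auto
  have aP: "a j \<in> carrier P" for j using a by blast
  have "a j \<noteq> a k" if jk: "j < d" "k < j" for j k
  proof
    let ?c = "a k \<otimes>\<^bsub>P\<^esub> a (d + prod_encode (j, k))"
    assume "a j = a k"
    then have "?c = ?c \<oplus>\<^bsub>P\<^esub> \<one>\<^bsub>P\<^esub>" using dist[OF jk] by simp
    then show False using aP by (simp add: P.add.r_cancel_one)
  qed
  then have inj: "inj_on a {..<d}" unfolding inj_on_def by (metis lessThan_iff linorder_neqE_nat)
  have p: "?p \<in> carrier (univ_poly P F)" "?p \<noteq> []"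
    unfolding univ_poly_carrier[symmetric] polynomial_def
    using q q0 P.one_not_zero by (auto simp: hd_map simp del: upt_Suc)
  note p' = P.carrier_polynomial_shell[OF subfieldE(1)[OF subfield_F] p(1)]
  have "a ` {..<d} \<subseteq> P.root_set ?p" using roots aP unfolding P.root_set_def by blast
  then have "card (a ` {..<d}) \<le> card (P.root_set ?p)"
    by (rule card_mono[OF P.root_set_bound(1)[OF p' p(2)]])
  then have "length ?p - 1 \<le> card (P.root_set ?p)" using card_image[OF inj] by simp
  moreover have "U \<in> P.root_set ?p" using U assms unfolding P.root_set_def by blast
  ultimately show ?thesis using p by blast
qed

theorem galois_P: "galois_extension P F"
  using galois_extensionI[OF P_field subfield_F root_in_P] .

end

section \<open>The Galois group of the cohesive power\<close>

lemma galois_group_memI: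
  assumes "\<rho> \<in> ring_hom L L" "\<rho> \<in> Bij (carrier L)" "\<And>x. x \<in> F \<Longrightarrow> \<rho> x = x"
  shows "\<rho> \<in> carrier (galois_group L F)"
  using assms unfolding galois_group_def by simp

lemma galois_group_memD:
  assumes "\<rho> \<in> carrier (galois_group L F)"
  shows "\<rho> \<in> ring_hom L L" "\<rho> \<in> Bij (carrier L)" "\<And>x. x \<in> F \<Longrightarrow> \<rho> x = x"
    "\<rho> \<in> extensional (carrier L)" "bij_betw \<rho> (carrier L) (carrier L)"
  using assms unfolding galois_group_def Bij_def by auto

lemma galois_group_mult:
  assumes "\<rho> \<in> carrier (galois_group L F)" "\<tau> \<in> carrier (galois_group L F)"
  shows "\<rho> \<otimes>\<^bsub>galois_group L F\<^esub> \<tau> = compose (carrier L) \<rho> \<tau>"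
  using galois_group_memD(2)[OF assms(1)] galois_group_memD(2)[OF assms(2)]
  by (simp add: galois_group_def BijGroup_def)

text \<open>Inverses and products in \<open>BijGroup\<close> are restricted to the carrier. Being a
  ring homomorphism depends only on the values there, so restriction preserves it.\<close>

lemma subgroup_galois_group:
  assumes L: "ring L" and F: "F \<subseteq> carrier L"
  shows "subgroup (carrier (galois_group L F)) (BijGroup (carrier L))"
proof (rule subgroup.intro)
  interpret ring L by fact
  show "carrier (galois_group L F) \<subseteq> carrier (BijGroup (carrier L))"
    using galois_group_memD(2) by (force simp: BijGroup_def)
  show "\<one>\<^bsub>BijGroup (carrier L)\<^esub> \<in> carrier (galois_group L F)"
    by (rule galois_group_memI) (use F in \<open>auto simp: BijGroup_def id_Bij ring_hom_def subset_iff\<close>)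
  fix \<rho> assume \<rho>: "\<rho> \<in> carrier (galois_group L F)"
  note \<rho>_D = galois_group_memD[OF \<rho>]
  let ?inv = "\<lambda>x\<in>carrier L. inv_into (carrier L) \<rho> x"
  have "\<rho> \<in> ring_iso L L" using \<rho>_D(1,5) unfolding ring_iso_def by blast
  then have "inv_into (carrier L) \<rho> \<in> ring_iso L L" by (rule ring_iso_set_sym[OF L])
  then have inv: "inv_into (carrier L) \<rho> \<in> ring_hom L L" unfolding ring_iso_def by blast
  have "?inv \<in> carrier (galois_group L F)"
  proof (rule galois_group_memI)
    show "?inv \<in> ring_hom L L"
      using ring_hom_restrict[OF inv, of ?inv] by simp
    show "?inv \<in> Bij (carrier L)" by (rule restrict_inv_into_Bij[OF \<rho>_D(2)])
    fix x assume "x \<in> F"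
    then have "x \<in> carrier L" "\<rho> x = x" using F \<rho>_D(3) by auto
    then show "?inv x = x"
      using bij_betw_inv_into_left[OF \<rho>_D(5), of x] by simp
  qed
  then show "inv\<^bsub>BijGroup (carrier L)\<^esub> \<rho> \<in> carrier (galois_group L F)"
    unfolding inv_BijGroup[OF \<rho>_D(2)] .
  fix \<tau> assume \<tau>: "\<tau> \<in> carrier (galois_group L F)"
  note \<tau>_D = galois_group_memD[OF \<tau>]
  have "compose (carrier L) \<rho> \<tau> \<in> carrier (galois_group L F)"
  proof (rule galois_group_memI)
    have "\<rho> \<circ> \<tau> \<in> ring_hom L L" by (rule ring_hom_trans[OF \<tau>_D(1) \<rho>_D(1)])
    then show "compose (carrier L) \<rho> \<tau> \<in> ring_hom L L"
      by (rule ring_hom_restrict) (simp add: compose_def)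
    show "compose (carrier L) \<rho> \<tau> \<in> Bij (carrier L)" by (rule compose_Bij[OF \<rho>_D(2) \<tau>_D(2)])
    show "compose (carrier L) \<rho> \<tau> x = x" if "x \<in> F" for x
      using that F \<rho>_D(3) \<tau>_D(3) by (auto simp: compose_def)
  qed
  then show "\<rho> \<otimes>\<^bsub>BijGroup (carrier L)\<^esub> \<tau> \<in> carrier (galois_group L F)"
    using \<rho>_D(2) \<tau>_D(2) by (simp add: BijGroup_def)
qed

lemma group_galois_group:
  assumes "ring L" "F \<subseteq> carrier L"
  shows "group (galois_group L F)"
proof -
  have "galois_group L F = BijGroup (carrier L)\<lparr>carrier := carrier (galois_group L F)\<rparr>"
    unfolding galois_group_def by simp
  then show ?thesis
    using subgroup.subgroup_is_group[OF subgroup_galois_group[OF assms] group_BijGroup] by simp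
qed

section \<open>Automorphisms of K acting pointwise\<close>

context cohesive_galois_number_field begin

abbreviation "G \<equiv> carrier (galois_group K Q)"

abbreviation "GP \<equiv> carrier (galois_group P F)"

text \<open>Despite the name, the chosen list is only required to span: coordinates are claimed to
  exist, not to be unique.\<close>

definition basis :: "nat list" where
  "basis = (SOME us. set us \<subseteq> carrier K \<and> Span Q us = carrier K)"

lemma basis: "set basis \<subseteq> carrier K" "Span Q basis = carrier K"
proof -
  have "\<exists>us. set us \<subseteq> carrier K \<and> Span Q us = carrier K"
    using finite_dimension_Q exists_base[OF subfield_Q] by blast
  from someI_ex[OF this] show "set basis \<subseteq> carrier K" "Span Q basis = carrier K"
    unfolding basis_def by blast+
qed

lemma basis_combine:
  assumes "x \<in> carrier K"
  shows "\<exists>q. range q \<subseteq> Q \<and> x = combine (map q [0..<length basis]) basis"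
proof -
  have "x \<in> Span Q basis" using assms basis(2) by simp
  then obtain ks where ks: "length ks = length basis" "set ks \<subseteq> Q" "x = combine ks basis"
    unfolding Span_eq_combine_set_length_version[OF subfield_Q basis(1)] by blast
  define q where "q j = (if j < length basis then ks ! j else \<zero>)" for j
  have "map q [0..<length basis] = ks" using ks(1) by (intro nth_equalityI) (auto simp: q_def)
  moreover have "range q \<subseteq> Q" using ks(1,2) Q_zero by (auto simp: q_def)
  ultimately show ?thesis using ks(3) by blast
qed

text \<open>Rational coordinates of the values of \<phi> can be searched for with the elements of
  \<open>basis\<close> as parameters, and parameters turn into diagonal classes under
  transfer.\<close>

lemma basis_combine_P:
  assumes "U \<in> carrier P"
  shows "\<exists>ks. set ks \<subseteq> F \<and> U = P.combine ks (map diag basis)"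
proof -
  obtain \<phi> where \<phi>: "\<phi> \<in> funs" "U = cl \<phi>" using assms unfolding carrier_P by blast
  let ?es = "[(Const (Given 0), comb_term 0 basis)]"
  have vars: "vars ?es \<subseteq> insert (Given 0) (range Rat \<union> Par ` set basis)"
    using consts_of_comb_term[of 0 basis] by (auto simp: vars_def)
  obtain a q where q: "range q \<subseteq> F" "satisfies P (case_var (\<lambda>j. cl ([\<phi>] ! j)) diag a q) ?es"
  proof (rule transfer_ae[of "[\<phi>]" ?es])
    fix i assume "\<forall>\<phi>\<in>set [\<phi>]. i \<in> dom \<phi>"
    then have "the (\<phi> i) \<in> carrier K" using value_in_carrier \<phi> by simp
    from basis_combine[OF this] obtain q where
      "range q \<subseteq> Q" "the (\<phi> i) = combine (map q [0..<length basis]) basis" by blast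
    then show "\<exists>a q. range a \<subseteq> carrier K \<and> range q \<subseteq> Q \<and>
        satisfies K (case_var (\<lambda>j. the (([\<phi>] ! j) i)) id a q) ?es"
      by (intro exI[of _ "\<lambda>_. \<zero>"] exI[of _ q]) (auto simp: satisfies_def rterm_val_comb_term)
  qed (use vars \<phi> basis(1) in auto)
  then have "U = P.combine (map q [0..<length basis]) (map diag basis)"
    using \<phi> by (simp add: satisfies_def P.rterm_val_comb_term)
  then show ?thesis using q(1) by (intro exI[of _ "map q [0..<length basis]"]) auto
qed

lemma hom_closed: "\<rho> \<in> ring_hom K K \<Longrightarrow> x \<in> carrier K \<Longrightarrow> \<rho> x \<in> carrier K"
  using ring_hom_closed by metis

lemma hom_combine_fixed:
  assumes R: "ring R" and h: "h \<in> ring_hom R R" and fixed: "\<And>x. x \<in> A \<Longrightarrow> h x = x"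
    and A: "A \<subseteq> carrier R" "set ks \<subseteq> A" "set us \<subseteq> carrier R"
  shows "h (ring.combine R ks us) = ring.combine R ks (map h us)"
proof -
  interpret ring_hom_ring R R h using ring_hom_ringI2[OF R R h] .
  have "map h ks = ks" using A(2) fixed by (intro map_idI) auto
  then show ?thesis using hom_combine[of ks us] A by auto
qed

text \<open>Finitely many parameters, \<open>basis\<close> and its image, determine \<rho>: write
  the argument in coordinates and take the same combination of the images. Different coordinates of
  one element give the same result, since \<rho> is linear over \<open>Q\<close>; hence the output
  unknown is unique.\<close>

lemma map_funs:
  assumes \<rho>: "\<rho> \<in> G" and \<phi>: "\<phi> \<in> funs"
  shows "(\<lambda>i. map_option \<rho> (\<phi> i)) \<in> funs"
proof -
  note \<rho>_D = galois_group_memD[OF \<rho>]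
  let ?es = "[(Const (Given 0), comb_term 0 basis), (Const (Unk 0), comb_term 0 (map \<rho> basis))]"
  have vars: "vars ?es \<subseteq> {Given 0, Unk 0} \<union> (range Rat \<union> Par ` (set basis \<union> \<rho> ` set basis))"
    using consts_of_comb_term[of 0 basis] consts_of_comb_term[of 0 "map \<rho> basis"] by (auto simp: vars_def)
  have sat: "satisfies K (case_var x id a q) ?es \<longleftrightarrow> x 0 = combine (map q [0..<length basis]) basis
      \<and> a 0 = combine (map q [0..<length basis]) (map \<rho> basis)" for x a q
    by (simp add: satisfies_def rterm_val_comb_term comp_def)
  have \<rho>_comb: "\<rho> (combine (map q [0..<length basis]) basis)
      = combine (map q [0..<length basis]) (map \<rho> basis)" if "range q \<subseteq> Q" for q
    using that by (intro hom_combine_fixed[OF ring_axioms \<rho>_D(1,3) Q_carrier _ basis(1)]) auto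
  have "partial_computable (\<lambda>i. if \<forall>\<phi>\<in>set [\<phi>]. i \<in> dom \<phi> then Some (\<rho> (the (([\<phi>] ! 0) i))) else None)"
  proof (rule partial_computable_definable[where es = ?es and f = "\<lambda>x. \<rho> (x 0)"])
    fix x assume "\<And>j. j < length [\<phi>] \<Longrightarrow> x j \<in> carrier K"
    then have x: "x 0 \<in> carrier K" by simp
    then obtain q where q: "range q \<subseteq> Q" "x 0 = combine (map q [0..<length basis]) basis"
      using basis_combine by blast
    show "\<exists>a q. range a \<subseteq> carrier K \<and> range q \<subseteq> Q \<and> satisfies K (case_var x id a q) ?es"
      unfolding sat using q \<rho>_comb[OF q(1)] hom_closed[OF \<rho>_D(1) x]
      by (intro exI[of _ "\<lambda>_. \<rho> (x 0)"] exI[of _ q]) auto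
  next
    fix x a q assume "range q \<subseteq> Q" "satisfies K (case_var x id a q) ?es"
    then show "a 0 = \<rho> (x 0)" unfolding sat using \<rho>_comb by simp
  next
    show "c \<in> carrier K" if "Par c \<in> vars ?es" for c
      using that vars basis(1) hom_closed[OF \<rho>_D(1)] by auto
    show "j < length [\<phi>]" if "Given j \<in> vars ?es" for j
      using that vars by auto
  qed (use funsE(1,2)[OF \<phi>] in auto)
  moreover have "(\<lambda>i. if \<forall>\<phi>\<in>set [\<phi>]. i \<in> dom \<phi> then Some (\<rho> (the (([\<phi>] ! 0) i))) else None)
      = (\<lambda>i. map_option \<rho> (\<phi> i))"
    by (auto simp: fun_eq_iff)
  moreover have "ran (\<lambda>i. map_option \<rho> (\<phi> i)) \<subseteq> carrier K"
    using hom_closed[OF \<rho>_D(1)] pointwise_in_carrier[OF \<phi>] by (auto simp: ran_def)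
  moreover have "dom (\<lambda>i. map_option \<rho> (\<phi> i)) = dom \<phi>" by (auto simp: dom_def)
  ultimately show ?thesis using \<phi> unfolding cohesive_funs_def by simp
qed

text \<open>A representative is chosen here and \<open>lift_cl\<close> shows that the choice is
  immaterial. The restriction to the carrier makes the map extensional, as membership in
  \<open>Bij\<close> demands.\<close>

definition lift :: "(nat \<Rightarrow> nat) \<Rightarrow> (nat \<rightharpoonup> nat) set \<Rightarrow> (nat \<rightharpoonup> nat) set" where
  "lift \<rho> = (\<lambda>U\<in>carrier P. cl (\<lambda>i. map_option \<rho> ((SOME \<phi>. \<phi> \<in> funs \<and> cl \<phi> = U) i)))"

lemma lift_cl:
  assumes \<rho>: "\<rho> \<in> G" and \<phi>: "\<phi> \<in> funs"
  shows "lift \<rho> (cl \<phi>) = cl (\<lambda>i. map_option \<rho> (\<phi> i))"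
proof -
  define \<psi> where "\<psi> = (SOME \<psi>. \<psi> \<in> funs \<and> cl \<psi> = cl \<phi>)"
  have \<psi>: "\<psi> \<in> funs" "cl \<psi> = cl \<phi>"
    using someI_ex[of "\<lambda>\<psi>. \<psi> \<in> funs \<and> cl \<psi> = cl \<phi>"] \<phi> unfolding \<psi>_def by blast+
  then have "\<forall>\<^sub>F i in ae. \<psi> i = \<phi> i" using cl_eq[OF \<psi>(1) \<phi>] by simp
  then have "\<forall>\<^sub>F i in ae. map_option \<rho> (\<psi> i) = map_option \<rho> (\<phi> i)" by eventually_elim simp
  then have "cl (\<lambda>i. map_option \<rho> (\<psi> i)) = cl (\<lambda>i. map_option \<rho> (\<phi> i))"
    using cl_eq[OF map_funs[OF \<rho> \<psi>(1)] map_funs[OF \<rho> \<phi>]] by simp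
  moreover have "cl \<phi> \<in> carrier P" using \<phi> carrier_P by blast
  ultimately show ?thesis unfolding lift_def \<psi>_def by simp
qed

lemma lift_closed: "\<rho> \<in> G \<Longrightarrow> U \<in> carrier P \<Longrightarrow> lift \<rho> U \<in> carrier P"
  using lift_cl map_funs unfolding carrier_P by force

lemma lift_hom:
  assumes \<rho>: "\<rho> \<in> G"
  shows "lift \<rho> \<in> ring_hom P P"
proof (rule ring_hom_memI)
  note \<rho>_hom = galois_group_memD(1)[OF \<rho>]
  show "lift \<rho> U \<in> carrier P" if "U \<in> carrier P" for U
    using lift_closed[OF \<rho> that] .
  have "lift \<rho> (cl (\<lambda>_. Some \<one>)) = cl (\<lambda>_. Some \<one>)"
    using lift_cl[OF \<rho> const_funs[of \<one>]] ring_hom_one[OF \<rho>_hom] by simp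
  then show "lift \<rho> \<one>\<^bsub>P\<^esub> = \<one>\<^bsub>P\<^esub>" by (simp add: P_zero_one diag_def)
  fix U V assume "U \<in> carrier P" "V \<in> carrier P"
  then obtain \<phi> \<psi> where \<phi>: "\<phi> \<in> funs" "U = cl \<phi>" and \<psi>: "\<psi> \<in> funs" "V = cl \<psi>"
    unfolding carrier_P by blast
  have "(\<lambda>i. map_option \<rho> (pointwise f \<phi> \<psi> i)) =
      pointwise f (\<lambda>i. map_option \<rho> (\<phi> i)) (\<lambda>i. map_option \<rho> (\<psi> i))"
    if "\<And>a b. a \<in> carrier K \<Longrightarrow> b \<in> carrier K \<Longrightarrow> \<rho> (f a b) = f (\<rho> a) (\<rho> b)" for f
    using that pointwise_in_carrier[OF \<phi>(1)] pointwise_in_carrier[OF \<psi>(1)]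
    by (auto simp: pointwise_def fun_eq_iff split: option.splits)
  note comm = this[of "(\<otimes>)", OF ring_hom_mult[OF \<rho>_hom]] this[of "(\<oplus>)", OF ring_hom_add[OF \<rho>_hom]]
  show "lift \<rho> (U \<otimes>\<^bsub>P\<^esub> V) = lift \<rho> U \<otimes>\<^bsub>P\<^esub> lift \<rho> V"
    using comm(1) \<phi> \<psi> by (simp add: P_ops(2) lift_cl[OF \<rho>] pointwise_funs map_funs[OF \<rho>])
  show "lift \<rho> (U \<oplus>\<^bsub>P\<^esub> V) = lift \<rho> U \<oplus>\<^bsub>P\<^esub> lift \<rho> V"
    using comm(2) \<phi> \<psi> by (simp add: P_ops(1) lift_cl[OF \<rho>] pointwise_funs map_funs[OF \<rho>])
qed

lemma lift_fixed:
  assumes \<rho>: "\<rho> \<in> G" and U: "U \<in> F"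
  shows "lift \<rho> U = U"
proof -
  obtain \<phi> where \<phi>: "\<phi> \<in> cohesive_funs C Q" "U = cl \<phi>"
    using U unfolding cohesive_subpower_def by blast
  have "map_option \<rho> (\<phi> i) = \<phi> i" for i
    using galois_group_memD(3)[OF \<rho>] funsE(2)[OF \<phi>(1)] by (cases "\<phi> i") (auto simp: ran_def)
  then show ?thesis using lift_cl[OF \<rho> subfuns[OF \<phi>(1)]] \<phi>(2) by simp
qed

lemma lift_diag: "\<rho> \<in> G \<Longrightarrow> c \<in> carrier K \<Longrightarrow> lift \<rho> (diag c) = diag (\<rho> c)"
  using lift_cl[OF _ const_funs] unfolding diag_def by simp

lemma lift_lift:
  assumes "\<rho> \<in> G" "\<tau> \<in> G" "U \<in> carrier P"
  shows "lift \<rho> (lift \<tau> U) = lift (compose (carrier K) \<rho> \<tau>) U"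
proof -
  interpret G: group "galois_group K Q"
    using group_galois_group[OF ring_axioms Q_carrier] .
  have comp: "compose (carrier K) \<rho> \<tau> \<in> G"
    using G.m_closed[OF assms(1,2)] galois_group_mult[OF assms(1,2)] by simp
  obtain \<phi> where \<phi>: "\<phi> \<in> funs" "U = cl \<phi>" using assms(3) unfolding carrier_P by blast
  have "map_option \<rho> (map_option \<tau> (\<phi> i)) = map_option (compose (carrier K) \<rho> \<tau>) (\<phi> i)" for i
    using pointwise_in_carrier[OF \<phi>(1)] by (cases "\<phi> i") (auto simp: compose_def)
  then show ?thesis
    using \<phi> lift_cl[OF assms(1) map_funs[OF assms(2)]] lift_cl[OF assms(2)] lift_cl[OF comp] by simp
qed

text \<open>Bijectivity comes from functoriality: the lift of the group inverse of \<rho> is a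
  two-sided inverse on the carrier.\<close>

lemma lift_galois:
  assumes \<rho>: "\<rho> \<in> G"
  shows "lift \<rho> \<in> GP"
proof (rule galois_group_memI[OF lift_hom[OF \<rho>] _ lift_fixed[OF \<rho>]])
  interpret G: group "galois_group K Q"
    using group_galois_group[OF ring_axioms Q_carrier] .
  define \<tau> where "\<tau> = inv\<^bsub>galois_group K Q\<^esub> \<rho>"
  have \<tau>: "\<tau> \<in> G" unfolding \<tau>_def using \<rho> by simp
  have one: "\<one>\<^bsub>galois_group K Q\<^esub> = (\<lambda>x\<in>carrier K. x)"
    by (simp add: galois_group_def BijGroup_def)
  have id: "lift \<one>\<^bsub>galois_group K Q\<^esub> U = U" if U: "U \<in> carrier P" for U
  proof -
    obtain \<phi> where \<phi>: "\<phi> \<in> funs" "U = cl \<phi>" using U unfolding carrier_P by blast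
    have "map_option \<one>\<^bsub>galois_group K Q\<^esub> (\<phi> i) = \<phi> i" for i
      using pointwise_in_carrier[OF \<phi>(1)] unfolding one by (cases "\<phi> i") auto
    then show ?thesis using \<phi> lift_cl[OF G.one_closed] by simp
  qed
  have "lift \<rho> (lift \<tau> U) = U" "lift \<tau> (lift \<rho> U) = U" if "U \<in> carrier P" for U
    using lift_lift[OF \<rho> \<tau> that] lift_lift[OF \<tau> \<rho> that] id[OF that] \<rho> \<tau>
    unfolding galois_group_mult[OF \<rho> \<tau>, symmetric] galois_group_mult[OF \<tau> \<rho>, symmetric]
    by (simp_all add: \<tau>_def)
  then have "bij_betw (lift \<rho>) (carrier P) (carrier P)"
    using lift_closed[OF \<rho>] lift_closed[OF \<tau>] by (intro bij_betw_byWitness[where f' = "lift \<tau>"]) auto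
  then show "lift \<rho> \<in> Bij (carrier P)" unfolding Bij_def lift_def by simp
qed

section \<open>Every automorphism is a unique lift\<close>

lemma lift_inj: "inj_on lift G"
proof (rule inj_onI)
  fix \<rho> \<tau> assume \<rho>: "\<rho> \<in> G" and \<tau>: "\<tau> \<in> G" and eq: "lift \<rho> = lift \<tau>"
  show "\<rho> = \<tau>"
  proof (rule extensionalityI[OF galois_group_memD(4)[OF \<rho>] galois_group_memD(4)[OF \<tau>]])
    fix c assume c: "c \<in> carrier K"
    then have "diag (\<rho> c) = diag (\<tau> c)" using lift_diag[OF \<rho> c] lift_diag[OF \<tau> c] eq by simp
    then show "\<rho> c = \<tau> c"
      using diag_inj hom_closed[OF galois_group_memD(1)[OF \<rho>] c] hom_closed[OF galois_group_memD(1)[OF \<tau>] c]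
      unfolding inj_on_def by blast
  qed
qed

text \<open>Passing to the cohesive power does not create new roots of a polynomial that already has as
  many roots as its degree.\<close>

lemma galois_P_diag:
  assumes \<tau>: "\<tau> \<in> GP" and c: "c \<in> carrier K" and b: "b \<in> root_set (Irr Q c)"
  shows "\<tau> (diag b) \<in> diag ` root_set (Irr Q c)"
proof -
  note \<tau>_D = galois_group_memD[OF \<tau>]
  let ?p = "Irr Q c"
  note p = galois_extension_roots[OF galois c]
  note p' = carrier_polynomial_shell[OF subfieldE(1)[OF subfield_Q] p(1)]
  note diag = inj_hom_poly[OF field_axioms P_field diag_hom diag_inj]
  have "inj_on \<tau> (carrier P)" using \<tau>_D(5) unfolding bij_betw_def by blast
  note \<tau>_poly = inj_hom_poly[OF P_field P_field \<tau>_D(1) this]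
  have "card (diag ` root_set ?p) = card (root_set ?p)"
    using diag_inj by (intro card_image) (auto simp: root_set_def inj_on_def)
  then have roots: "P.root_set (map diag ?p) = diag ` root_set ?p"
    using p by (intro P.full_root_set[OF diag(1)[OF p'] _ diag(5)[OF p']]) auto
  have "set ?p \<subseteq> Q" using p(1) unfolding univ_poly_carrier[symmetric] polynomial_def by auto
  \<comment> \<open>The coefficients are diagonal classes of rationals, hence fixed by \<tau>, so
    \<tau> carries roots of the polynomial to roots of the same polynomial.\<close>
  then have "map \<tau> (map diag ?p) = map diag ?p"
    using \<tau>_D(3) diag_F by (intro map_idI) auto
  then have "\<tau> ` P.root_set (map diag ?p) \<subseteq> P.root_set (map diag ?p)"
    using \<tau>_poly(5)[OF diag(1)[OF p']] by (simp only:)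
  then show ?thesis unfolding roots using b by blast
qed

lemma lift_surj:
  assumes \<tau>: "\<tau> \<in> GP"
  shows "\<exists>\<rho>\<in>G. lift \<rho> = \<tau>"
proof -
  note \<tau>_D = galois_group_memD[OF \<tau>]
  \<comment> \<open>The use of \<open>inv_into\<close> is justified by \<open>galois_P_diag\<close>,
    which places the image of every diagonal class in the diagonal copy of \<open>K\<close>.\<close>
  define \<rho> where "\<rho> = (\<lambda>c\<in>carrier K. inv_into (carrier K) diag (\<tau> (diag c)))"
  have self: "c \<in> root_set (Irr Q c)" if "c \<in> carrier K" for c
    using galois_extension_roots(4)[OF galois that] .
  have roots: "\<rho> b \<in> root_set (Irr Q c) \<and> diag (\<rho> b) = \<tau> (diag b)"
    if c: "c \<in> carrier K" and b: "b \<in> root_set (Irr Q c)" for b c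
  proof -
    obtain a where a: "a \<in> root_set (Irr Q c)" "\<tau> (diag b) = diag a"
      using galois_P_diag[OF \<tau> c b] by blast
    then have "inv_into (carrier K) diag (\<tau> (diag b)) = a"
      using inv_into_f_f[OF diag_inj, of a] unfolding root_set_def by simp
    then have "\<rho> b = a" using b unfolding \<rho>_def root_set_def by simp
    then show ?thesis using a by simp
  qed
  have diag_\<rho>: "diag (\<rho> c) = \<tau> (diag c)" and closed: "\<rho> c \<in> carrier K" if "c \<in> carrier K" for c
    using roots[OF that self[OF that]] unfolding root_set_def by blast+
  \<comment> \<open>Identities for \<rho> are checked after applying \<open>diag\<close>, where they
    become identities for \<tau>.\<close>
  have eqI: "a = b" if "diag a = diag b" "a \<in> carrier K" "b \<in> carrier K" for a b
    using that diag_inj unfolding inj_on_def by blast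
  note diag_simps = ring_hom_mult[OF diag_hom] ring_hom_add[OF diag_hom] ring_hom_one[OF diag_hom]
  have hom: "\<rho> \<in> ring_hom K K"
  proof (rule ring_hom_memI)
    fix a b assume a: "a \<in> carrier K" and b: "b \<in> carrier K"
    show "\<rho> (a \<otimes> b) = \<rho> a \<otimes> \<rho> b"
      using a b by (intro eqI)
        (simp_all add: closed diag_\<rho> diag_simps ring_hom_mult[OF \<tau>_D(1)] diag_closed)
    show "\<rho> (a \<oplus> b) = \<rho> a \<oplus> \<rho> b"
      using a b by (intro eqI)
        (simp_all add: closed diag_\<rho> diag_simps ring_hom_add[OF \<tau>_D(1)] diag_closed)
  next
    show "\<rho> \<one> = \<one>"
      by (intro eqI) (simp_all add: closed diag_\<rho> diag_simps ring_hom_one[OF \<tau>_D(1)])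
  qed (rule closed)
  have inj: "inj_on \<rho> (carrier K)"
    by (rule non_trivial_field_hom_is_inj[OF hom field_axioms field_axioms])
  \<comment> \<open>Surjectivity is found inside a finite set: \<rho> maps the roots of the minimal
    polynomial of \<open>c\<close> injectively to themselves, hence permutes them, and
    \<open>c\<close> is one of them.\<close>
  have "\<exists>b\<in>carrier K. \<rho> b = c" if c: "c \<in> carrier K" for c
  proof -
    let ?S = "root_set (Irr Q c)"
    have "finite ?S"
      using galois_extension_roots(1,2)[OF galois c]
      by (intro root_set_bound(1) carrier_polynomial_shell[OF subfieldE(1)[OF subfield_Q]])
    moreover have "\<rho> ` ?S \<subseteq> ?S" using roots[OF c] by blast
    moreover have "inj_on \<rho> ?S" using inj by (rule inj_on_subset) (auto simp: root_set_def)
    ultimately have "\<rho> ` ?S = ?S" by (rule endo_inj_surj)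
    then have "c \<in> \<rho> ` ?S" using self[OF c] by simp
    then show ?thesis unfolding root_set_def by blast
  qed
  then have "bij_betw \<rho> (carrier K) (carrier K)"
    unfolding bij_betw_def using inj closed by blast
  then have "\<rho> \<in> Bij (carrier K)" unfolding Bij_def \<rho>_def by simp
  moreover have "\<rho> x = x" if "x \<in> Q" for x
    using that Q_carrier diag_F \<tau>_D(3) by (intro eqI closed) (auto simp: diag_\<rho>)
  ultimately have \<rho>: "\<rho> \<in> G" by (intro galois_group_memI[OF hom])
  have "lift \<rho> = \<tau>"
  proof (rule extensionalityI[OF galois_group_memD(4)[OF lift_galois[OF \<rho>]] \<tau>_D(4)])
    fix U assume "U \<in> carrier P"
    then obtain ks where ks: "set ks \<subseteq> F" "U = P.combine ks (map diag basis)"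
      using basis_combine_P by blast
    have us: "set (map diag basis) \<subseteq> carrier P" using basis(1) diag_closed by auto
    \<comment> \<open>Both maps are linear over \<open>F\<close>, so agreement on the spanning list
      of diagonal classes settles equality on all of \<open>P\<close>.\<close>
    have "map (lift \<rho>) (map diag basis) = map \<tau> (map diag basis)"
      using basis(1) lift_diag[OF \<rho>] diag_\<rho> by auto
    then show "lift \<rho> U = \<tau> U"
      unfolding ks(2)
      using hom_combine_fixed[OF P.ring_axioms lift_hom[OF \<rho>] lift_fixed[OF \<rho>] F_carrier ks(1) us]
        hom_combine_fixed[OF P.ring_axioms \<tau>_D(1,3) F_carrier ks(1) us] by (simp only:)
  qed
  then show ?thesis using \<rho> by blast
qed

theorem galois_group_iso: "galois_group P F \<cong> galois_group K Q"
proof -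
  interpret G: group "galois_group K Q"
    using group_galois_group[OF ring_axioms Q_carrier] .
  have "lift \<in> hom (galois_group K Q) (galois_group P F)"
  proof (rule homI)
    show "lift \<rho> \<in> GP" if "\<rho> \<in> G" for \<rho> using lift_galois[OF that] .
    fix \<rho> \<tau> assume \<rho>: "\<rho> \<in> G" and \<tau>: "\<tau> \<in> G"
    have "lift (compose (carrier K) \<rho> \<tau>) = compose (carrier P) (lift \<rho>) (lift \<tau>)"
      by (rule extensionalityI[of _ "carrier P"])
        (simp_all add: compose_eq lift_lift[OF \<rho> \<tau>] compose_extensional, simp add: lift_def)
    then show "lift (\<rho> \<otimes>\<^bsub>galois_group K Q\<^esub> \<tau>) = lift \<rho> \<otimes>\<^bsub>galois_group P F\<^esub> lift \<tau>"
      unfolding galois_group_mult[OF \<rho> \<tau>] galois_group_mult[OF lift_galois[OF \<rho>] lift_galois[OF \<tau>]] .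
  qed
  moreover have "bij_betw lift G GP"
    unfolding bij_betw_def using lift_inj lift_galois lift_surj by blast
  ultimately have "galois_group K Q \<cong> galois_group P F"
    unfolding is_iso_def Group.iso_def by blast
  then show ?thesis by (rule G.iso_sym)
qed

end

theorem corollary3p9:
  fixes K :: "nat ring" and C :: "nat set"
  assumes "number_field K"
    and "computable_structure K"
    and "cohesive C"
    and "galois_extension K (prime_subfield K)"
  shows "galois_extension (cohesive_power C K) (cohesive_subpower C K (prime_subfield K)) \<and>
         galois_group (cohesive_power C K) (cohesive_subpower C K (prime_subfield K))
           \<cong> galois_group K (prime_subfield K)"
proof -
  interpret cohesive_galois_number_field K "prime_subfield K" C
    using assms
    by (simp add: cohesive_galois_number_field_def cohesive_galois_number_field_axioms_def
        cohesive_number_field_def cohesive_number_field_axioms_def computable_number_field_def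
        computable_number_field_axioms_def galois_extension_def)
  show ?thesis using galois_P galois_group_iso by blast
qed

end
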